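(* Let $$X=\Big\{z\in\mathbb{C}:|z|\le\frac{1}{1-2\times5^{-5/8}}\Big\},\qquad U=\{t\in\mathbb{C}:|t|<2\times5^{-5/8},\ t\notin\mathbb{R}\}.$$ For $t\in U$ and $j\in\mathbb{N}$ let $I^{(j)}=\{1,2\}$, and define $\phi_{1,t}^{(j)},\phi_{2,t}^{(j)}:X\to X$ by $\phi_{1,t}^{(j)}(z)=tz$ and $\phi_{2,t}^{(j)}(z)=tz+\frac1j$. Let $\Phi_t^{(j)}=\{\phi_{1,t}^{(j)},\phi_{2,t}^{(j)}\}$ and $\Phi_t=(\Phi_t^{(j)})_{j=1}^\infty$. Then the family $\{\Phi_t\}_{t\in U}$ is a transversal family of non-autonomous conformal iterated function systems (TNCIFS), but $\Phi_t$ does not satisfy the open set condition for any $t\in U$.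
   Context: $\mathbb{N}=\{1,2,\dots\}$; $\mathbb{C}$ is identified with $\mathbb{R}^2$ (so below $m=d=2$); $|\cdot|$ is the Euclidean norm; $\mathcal{L}_d$ is Lebesgue measure on $\mathbb{R}^d$. Open set condition: a sequence $(\{\phi_i^{(j)}\}_{i\in I^{(j)}})_{j=1}^\infty$ of finite collections of uniformly contracting self-maps of a compact set $X$ with $\mathrm{int}(X)\neq\emptyset$ satisfies the open set condition if for all $j\in\mathbb{N}$ and all distinct $a,b\in I^{(j)}$, $\phi_a^{(j)}(\mathrm{int}(X))\cap\phi_b^{(j)}(\mathrm{int}(X))=\emptyset$. Definition of TNCIFS. Let $m,d\in\mathbb{N}$, let $X\subset\mathbb{R}^m$ be non-empty compact convex, let $U\subset\mathbb{R}^d$ be non-empty open, and for each $j\in\mathbb{N}$ let $I^{(j)}$ be a finite set. For $n\le k$ put $I_n^k=\prod_{j=n}^kI^{(j)}$, $I_n^\infty=\prod_{j=n}^\infty I^{(j)}$ (product topology). For $t\in U$ let $\Phi_t=(\Phi_t^{(j)})_{j=1}^\infty$, $\Phi_t^{(j)}=\{\phi_{i,t}^{(j)}:X\to X\}_{i\in I^{(j)}}$. For $\omega=\omega_n\cdots\omega_k\in I_n^k$ put $\phi_{\omega,t}=\phi_{\omega_n,t}^{(n)}\circ\cdots\circ\phi_{\omega_k,t}^{(k)}$. For $\omega\in I_n^\infty$ and $j\in\mathbb{N}$ put $\omega|_j=\omega_n\cdots\omega_{n+j-1}$. A diffeomorphism $\phi:V\to\phi(V)$ on an open $V\subset\mathbb{R}^m$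 is conformal if for every $x\in V$, $D\phi(x)=c_xA_x$ with $c_x>0$ and $A_x$ orthogonal; then $|D\phi(x)|:=c_x$, and $\|D\phi\|_A:=\sup\{|D\phi(x)|:x\in A\}$ for $A\subset V$. $\{\Phi_t\}_{t\in U}$ is a TNCIFS if: 1. Conformality: there is an open connected set $V\supset X$ (independent of $i,j,t$) such that every $\phi_{i,t}^{(j)}$ extends to a $C^1$ conformal map on $V$ with $\phi_{i,t}^{(j)}(V)\subset V$. 2. Uniform contraction: there is $0<\gamma<1$ such that $|D\phi_{\omega|_j,t}(x)|\le\gamma^j$ for all $t\in U$, $n,j\in\mathbb{N}$, $\omega\in I_n^\infty$, $x\in V$. 3. Bounded distortion: there is a continuous function $K:U\to[1,\infty)$ such that $|D\phi_{\omega|_j,t}(x_1)|\le K(t)|D\phi_{\omega|_j,t}(x_2)|$ for all $t\in U$, $n,j\in\mathbb{N}$, $\omega\in I_n^\infty$, $x_1,x_2\in V$. 4. Distortion continuity: for every $\eta>0$ and $t_0\in U$ there is $\delta=\delta(\eta,t_0)>0$ such that for all $t\in U$ with $|t-t_0|\le\delta$, all $n,j\in\mathbb{N}$ and $\omega\in I_n^\infty$, $\exp(-j\eta)\le\|D\phi_{\omega|_j,t_0}\|_X/\|D\phi_{\omega|_j,t}\|_X\le\exp(j\eta)$. For $t\in U$, $n\in\mathbb{N}$, $\omega\in I_n^\infty$, the set $\bigcap_{j\ge1}\phi_{\omega|_j,t}(X)$ is a singleton; its unique point is denoted $\pi_{n,t}(\omega)$. 5. Continuity: for each $n\in\mathbb{N}$,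 $U\times I_n^\infty\ni(t,\omega)\mapsto\pi_{n,t}(\omega)$ is continuous. 6. Transversality: for every compact $G\subset U$ there is a sequence $\{C_n\}_{n\ge1}$ of positive constants with $\lim_{n\to\infty}\frac{\log C_n}{n}=0$ such that for all $n\in\mathbb{N}$, all $\omega,\tau\in I_n^\infty$ with $\omega_n\ne\tau_n$ and all $r>0$, $\mathcal{L}_d(\{t\in G:|\pi_{n,t}(\omega)-\pi_{n,t}(\tau)|\le r\})\le C_nr^m$. *)

theory Defs
  imports "HOL-Analysis.Analysis"
begin

definition C1_on :: "('a::euclidean_space \<Rightarrow> 'b::euclidean_space) \<Rightarrow> 'a set \<Rightarrow> bool" where
  "C1_on f V \<longleftrightarrow>
     (\<exists>D :: 'a \<Rightarrow> 'a \<Rightarrow>\<^sub>L 'b.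
        (\<forall>x\<in>V. (f has_derivative blinfun_apply (D x)) (at x)) \<and> continuous_on V D)"

definition C1_diffeo_on :: "('a::euclidean_space \<Rightarrow> 'a) \<Rightarrow> 'a set \<Rightarrow> bool" where
  "C1_diffeo_on f V \<longleftrightarrow>
     open V \<and> open (f ` V) \<and> inj_on f V \<and> C1_on f V \<and> C1_on (inv_into V f) (f ` V)"

definition has_conformal_factor :: "('a::euclidean_space \<Rightarrow> 'a) \<Rightarrow> 'a \<Rightarrow> real \<Rightarrow> bool" where
  "has_conformal_factor f x c \<longleftrightarrow>
     c > 0 \<and> (\<exists>A. orthogonal_transformation A \<and> (f has_derivative (\<lambda>v. c *\<^sub>R A v)) (at x))"

definition conformal_on :: "('a::euclidean_space \<Rightarrow> 'a) \<Rightarrow> 'a set \<Rightarrow> bool" where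
  "conformal_on f V \<longleftrightarrow> C1_diffeo_on f V \<and> (\<forall>x\<in>V. \<exists>c. has_conformal_factor f x c)"

text \<open>The number written $|D f(x)|$ for a conformal map $f$; it is unique by the lemma below.\<close>

definition conformal_factor :: "('a::euclidean_space \<Rightarrow> 'a) \<Rightarrow> 'a \<Rightarrow> real" where
  "conformal_factor f x = (THE c. has_conformal_factor f x c)"

lemma has_conformal_factor_unique:
  assumes "has_conformal_factor f x c" and "has_conformal_factor f x c'"
  shows "c = c'"
proof -
  from assms obtain A B where c: "c > 0" "c' > 0"
    and A: "orthogonal_transformation A" "(f has_derivative (\<lambda>v. c *\<^sub>R A v)) (at x)"
    and B: "orthogonal_transformation B" "(f has_derivative (\<lambda>v. c' *\<^sub>R B v)) (at x)"
    unfolding has_conformal_factor_def by blast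
  have eq: "(\<lambda>v. c *\<^sub>R A v) = (\<lambda>v. c' *\<^sub>R B v)"
    using A(2) B(2) by (rule has_derivative_unique)
  obtain b :: 'a where b: "b \<in> Basis"
    using nonempty_Basis by blast
  have "norm (c *\<^sub>R A b) = norm (c' *\<^sub>R B b)"
    using fun_cong[OF eq, of b] by simp
  then show ?thesis
    using c b A(1) B(1) by (simp add: orthogonal_transformation)
qed

lemma conformal_factor_eq: "has_conformal_factor f x c \<Longrightarrow> conformal_factor f x = c"
  unfolding conformal_factor_def by (blast intro: has_conformal_factor_unique)

text \<open>
  Levels of a non-autonomous system are numbered from 1, so that level indices below are always
  guarded by \<open>1 \<le> n\<close>; the values at level 0 are irrelevant. A system is a function
  \<open>F\<close> with \<open>F j i\<close> the map of index \<open>i\<close> at level \<open>j\<close>.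
\<close>

definition words_from :: "(nat \<Rightarrow> 'i set) \<Rightarrow> nat \<Rightarrow> (nat \<Rightarrow> 'i) set" where
  "words_from I n = (\<Pi>\<^sub>E j\<in>{n..}. I j)"

definition words_topology :: "(nat \<Rightarrow> 'i set) \<Rightarrow> nat \<Rightarrow> (nat \<Rightarrow> 'i) topology" where
  "words_topology I n = product_topology (\<lambda>j. discrete_topology (I j)) {n..}"

text \<open>
  \<open>word_map F n j \<omega>\<close> is the composition along the first \<open>j\<close> letters
  \<open>\<omega> n, \<dots>, \<omega> (n + j - 1)\<close> of a word starting at level \<open>n\<close>.
\<close>

primrec word_map ::
  "(nat \<Rightarrow> 'i \<Rightarrow> 'a \<Rightarrow> 'a) \<Rightarrow> nat \<Rightarrow> nat \<Rightarrow> (nat \<Rightarrow> 'i) \<Rightarrow> 'a \<Rightarrow> 'a" where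
  "word_map F n 0 \<omega> = id"
| "word_map F n (Suc j) \<omega> = word_map F n j \<omega> \<circ> F (n + j) (\<omega> (n + j))"

definition coding_map ::
  "'a set \<Rightarrow> (nat \<Rightarrow> 'i \<Rightarrow> 'a \<Rightarrow> 'a) \<Rightarrow> nat \<Rightarrow> (nat \<Rightarrow> 'i) \<Rightarrow> 'a" where
  "coding_map X F n \<omega> = (THE x. (\<Inter>j\<in>{1..}. word_map F n j \<omega> ` X) = {x})"

text \<open>
  In the following, \<open>\<Phi> t j i\<close> is the map of index \<open>i\<close> at level \<open>j\<close> for the parameter \<open>t\<close>, and only its
  values on \<open>X\<close> matter. \<open>\<Psi>\<close> is a choice of extensions of these maps to \<open>V\<close>, which is where the
  derivatives are taken.
\<close>

definition conformality ::
  "'a::euclidean_space set \<Rightarrow> 'p set \<Rightarrow> (nat \<Rightarrow> 'i set) \<Rightarrow> ('p \<Rightarrow> nat \<Rightarrow> 'i \<Rightarrow> 'a \<Rightarrow> 'a) \<Rightarrow>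
   'a set \<Rightarrow> ('p \<Rightarrow> nat \<Rightarrow> 'i \<Rightarrow> 'a \<Rightarrow> 'a) \<Rightarrow> bool" where
  "conformality X U I \<Phi> V \<Psi> \<longleftrightarrow>
     open V \<and> connected V \<and> X \<subseteq> V \<and>
     (\<forall>t\<in>U. \<forall>j\<ge>1. \<forall>i\<in>I j.
        (\<forall>x\<in>X. \<Psi> t j i x = \<Phi> t j i x) \<and> conformal_on (\<Psi> t j i) V \<and> \<Psi> t j i ` V \<subseteq> V)"

definition uniform_contraction ::
  "'p set \<Rightarrow> (nat \<Rightarrow> 'i set) \<Rightarrow> 'a::euclidean_space set \<Rightarrow>
   ('p \<Rightarrow> nat \<Rightarrow> 'i \<Rightarrow> 'a \<Rightarrow> 'a) \<Rightarrow> bool" where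
  "uniform_contraction U I V \<Psi> \<longleftrightarrow>
     (\<exists>\<gamma>. 0 < \<gamma> \<and> \<gamma> < 1 \<and>
        (\<forall>t\<in>U. \<forall>n\<ge>1. \<forall>j\<ge>1. \<forall>\<omega>\<in>words_from I n. \<forall>x\<in>V.
           conformal_factor (word_map (\<Psi> t) n j \<omega>) x \<le> \<gamma> ^ j))"

definition bounded_distortion ::
  "'p::topological_space set \<Rightarrow> (nat \<Rightarrow> 'i set) \<Rightarrow> 'a::euclidean_space set \<Rightarrow>
   ('p \<Rightarrow> nat \<Rightarrow> 'i \<Rightarrow> 'a \<Rightarrow> 'a) \<Rightarrow> bool" where
  "bounded_distortion U I V \<Psi> \<longleftrightarrow>
     (\<exists>K. continuous_on U K \<and> (\<forall>t\<in>U. (1::real) \<le> K t) \<and>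
        (\<forall>t\<in>U. \<forall>n\<ge>1. \<forall>j\<ge>1. \<forall>\<omega>\<in>words_from I n. \<forall>x1\<in>V. \<forall>x2\<in>V.
           conformal_factor (word_map (\<Psi> t) n j \<omega>) x1
             \<le> K t * conformal_factor (word_map (\<Psi> t) n j \<omega>) x2))"

definition sup_conformal_factor :: "'a::euclidean_space set \<Rightarrow> ('a \<Rightarrow> 'a) \<Rightarrow> real" where
  "sup_conformal_factor A f = (SUP x\<in>A. conformal_factor f x)"

definition distortion_continuity ::
  "'a::euclidean_space set \<Rightarrow> 'p::real_normed_vector set \<Rightarrow> (nat \<Rightarrow> 'i set) \<Rightarrow>
   ('p \<Rightarrow> nat \<Rightarrow> 'i \<Rightarrow> 'a \<Rightarrow> 'a) \<Rightarrow> bool" where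
  "distortion_continuity X U I \<Psi> \<longleftrightarrow>
     (\<forall>\<eta>>0. \<forall>t0\<in>U. \<exists>\<delta>>0. \<forall>t\<in>U. norm (t - t0) \<le> \<delta> \<longrightarrow>
        (\<forall>n\<ge>1. \<forall>j\<ge>1. \<forall>\<omega>\<in>words_from I n.
           exp (- (real j * \<eta>))
             \<le> sup_conformal_factor X (word_map (\<Psi> t0) n j \<omega>)
                / sup_conformal_factor X (word_map (\<Psi> t) n j \<omega>) \<and>
           sup_conformal_factor X (word_map (\<Psi> t0) n j \<omega>)
                / sup_conformal_factor X (word_map (\<Psi> t) n j \<omega>)
             \<le> exp (real j * \<eta>)))"

definition coding_continuity ::
  "'a::euclidean_space set \<Rightarrow> 'p::topological_space set \<Rightarrow> (nat \<Rightarrow> 'i set) \<Rightarrow>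
   ('p \<Rightarrow> nat \<Rightarrow> 'i \<Rightarrow> 'a \<Rightarrow> 'a) \<Rightarrow> bool" where
  "coding_continuity X U I \<Phi> \<longleftrightarrow>
     (\<forall>n\<ge>1. continuous_map (prod_topology (top_of_set U) (words_topology I n)) euclidean
        (\<lambda>(t, \<omega>). coding_map X (\<Phi> t) n \<omega>))"

text \<open>
  The sets measured here are closed, hence measurable, as soon as \<open>coding_continuity\<close> holds.
\<close>

definition transversality ::
  "'a::euclidean_space set \<Rightarrow> 'p::euclidean_space set \<Rightarrow> (nat \<Rightarrow> 'i set) \<Rightarrow>
   ('p \<Rightarrow> nat \<Rightarrow> 'i \<Rightarrow> 'a \<Rightarrow> 'a) \<Rightarrow> bool" where
  "transversality X U I \<Phi> \<longleftrightarrow>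
     (\<forall>G. compact G \<and> G \<subseteq> U \<longrightarrow>
        (\<exists>C :: nat \<Rightarrow> real.
           (\<forall>n\<ge>1. C n > 0) \<and> (\<lambda>n. ln (C n) / real n) \<longlonglongrightarrow> 0 \<and>
           (\<forall>n\<ge>1. \<forall>\<omega>\<in>words_from I n. \<forall>\<tau>\<in>words_from I n. \<omega> n \<noteq> \<tau> n \<longrightarrow>
              (\<forall>r>0. emeasure lebesgue
                       {t \<in> G. norm (coding_map X (\<Phi> t) n \<omega> - coding_map X (\<Phi> t) n \<tau>) \<le> r}
                     \<le> ennreal (C n * r ^ DIM('a))))))"

definition TNCIFS ::
  "'a::euclidean_space set \<Rightarrow> 'p::euclidean_space set \<Rightarrow> (nat \<Rightarrow> 'i set) \<Rightarrow>
   ('p \<Rightarrow> nat \<Rightarrow> 'i \<Rightarrow> 'a \<Rightarrow> 'a) \<Rightarrow> bool" where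
  "TNCIFS X U I \<Phi> \<longleftrightarrow>
     X \<noteq> {} \<and> compact X \<and> convex X \<and>
     U \<noteq> {} \<and> open U \<and>
     (\<forall>j\<ge>1. finite (I j)) \<and>
     (\<forall>t\<in>U. \<forall>j\<ge>1. \<forall>i\<in>I j. \<Phi> t j i ` X \<subseteq> X) \<and>
     (\<exists>V \<Psi>. conformality X U I \<Phi> V \<Psi> \<and>
            uniform_contraction U I V \<Psi> \<and>
            bounded_distortion U I V \<Psi> \<and>
            distortion_continuity X U I \<Psi>) \<and>
     coding_continuity X U I \<Phi> \<and>
     transversality X U I \<Phi>"

text \<open>
  The standing assumptions under which this condition is considered (\<open>X\<close> compact with non-empty
  interior, finitely many uniformly contracting self-maps at each level) are deliberately not
  conjuncts: the negation then says exactly that two images of the interior overlap.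
\<close>

definition open_set_condition ::
  "'a::topological_space set \<Rightarrow> (nat \<Rightarrow> 'i set) \<Rightarrow> (nat \<Rightarrow> 'i \<Rightarrow> 'a \<Rightarrow> 'a) \<Rightarrow> bool" where
  "open_set_condition X I F \<longleftrightarrow>
     (\<forall>j\<ge>1. \<forall>a\<in>I j. \<forall>b\<in>I j. a \<noteq> b \<longrightarrow> F j a ` interior X \<inter> F j b ` interior X = {})"

definition disc_X :: "complex set" where
  "disc_X = {z. cmod z \<le> 1 / (1 - 2 * 5 powr (- 5 / 8))}"

definition param_U :: "complex set" where
  "param_U = {t. cmod t < 2 * 5 powr (- 5 / 8) \<and> t \<notin> \<real>}"

definition index_I :: "nat \<Rightarrow> nat set" where
  "index_I j = {1, 2}"

definition family_Phi :: "complex \<Rightarrow> nat \<Rightarrow> nat \<Rightarrow> complex \<Rightarrow> complex" where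
  "family_Phi t j i z = (if i = 1 then t * z else t * z + 1 / of_nat j)"

end

theory Submission
  imports Defs
begin

text \<open>
  The maps at every level are \<open>z \<mapsto> t z + c\<close>, so all derivatives along words of length \<open>j\<close> have modulus
  \<open>norm t ^ j\<close> and the coding map is a power series in \<open>t\<close>. If two words starting at level \<open>n\<close> differ in
  their first letter, then \<open>n\<close> times the difference of their codings is, up to sign, a power series
  with constant term 1 and real coefficients in \<open>[-1, 1]\<close>. Such a series has no nonreal double zero
  of modulus less than \<open>2 * 5 powr (- 5 / 8)\<close>: the conjugate of the zero would be a double zero too,
  and dividing out the four Blaschke factors after rescaling the variable by \<open>R\<close> shows that a double
  zero \<open>z\<close> satisfies \<open>norm z ^ 8 \<ge> R ^ 8 * (1 - R\<^sup>2)\<close>, which is optimal for \<open>R\<^sup>2 = 4 / 5\<close>. By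
  compactness of the set of coefficient sequences, the series and its derivative are not
  simultaneously small on a compact set of parameters, and the area of each sublevel set is at most
  a constant times \<open>r\<^sup>2\<close>. The factor \<open>n\<close> turns this constant into \<open>C * n\<^sup>2\<close>, which is
  subexponential. The open set condition fails because at level \<open>j\<close> the two images of the interior
  are translates of each other by \<open>1 / j\<close>.
\<close>

section \<open>Blaschke factors and double zeros\<close>

lemma summable_power_series_geometric_bound:
  fixes f :: "nat \<Rightarrow> complex"
  assumes q: "0 \<le> q" "q < 1" and bound: "\<And>k. norm (f k) \<le> C * q ^ k" and z: "norm z \<le> 1"
  shows "summable (\<lambda>k. f k * z ^ k)"
proof (rule summable_comparison_test')
  show "summable (\<lambda>k. C * q ^ k)"
    using q by (intro summable_mult summable_geometric) auto
  fix k :: nat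
  have "norm (f k * z ^ k) \<le> (C * q ^ k) * 1"
    unfolding norm_mult norm_power using bound z
    by (intro mult_mono power_le_one) (auto intro: order_trans[OF norm_ge_zero bound])
  then show "norm (f k * z ^ k) \<le> C * q ^ k" by simp
qed

lemma summable_norm_square_geometric_bound:
  fixes f :: "nat \<Rightarrow> complex"
  assumes q: "0 \<le> q" "q < 1" and bound: "\<And>k. norm (f k) \<le> C * q ^ k"
  shows "summable (\<lambda>k. (norm (f k))\<^sup>2)"
proof (rule summable_comparison_test')
  show "summable (\<lambda>k. C\<^sup>2 * (q\<^sup>2) ^ k)"
    using q by (intro summable_mult summable_geometric) (auto simp: power_less_one_iff abs_square_less_1)
  fix k :: nat
  have "(norm (f k))\<^sup>2 \<le> (C * q ^ k)\<^sup>2"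
    by (intro power_mono bound) auto
  then show "norm ((norm (f k))\<^sup>2) \<le> C\<^sup>2 * (q\<^sup>2) ^ k"
    by (simp add: power_mult_distrib power_mult[symmetric] mult.commute)
qed

text \<open>Both squares on the left have the same cross term, which cancels. Summed over
  coefficients, with \<open>a\<close> running through a shift of the sequence of \<open>b\<close>,
  the right-hand side vanishes; this is why Blaschke factors preserve the l2 norm.\<close>

lemma cmod_Blaschke_swap:
  "(cmod (a - w * b))\<^sup>2 - (cmod (b - cnj w * a))\<^sup>2 = (1 - (cmod w)\<^sup>2) * ((cmod a)\<^sup>2 - (cmod b)\<^sup>2)"
  unfolding cmod_power2 by (simp add: power2_eq_square algebra_simps)

text \<open>The power series of \<open>g\<close> is that of \<open>f\<close> divided by
  \<open>(z - w) / (1 - cnj w * z)\<close>, a factor of modulus 1 on the unit circle. The argument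
  works with coefficients only; keeping the rate \<open>q\<close> in the bound for \<open>g\<close>
  allows the division to be iterated.\<close>

lemma Blaschke_division:
  fixes f :: "nat \<Rightarrow> complex"
  assumes q: "0 \<le> q" "q < 1" and bound: "\<And>k. norm (f k) \<le> C * q ^ k"
    and w: "norm w < 1" "w \<noteq> 0" and zero: "(\<Sum>k. f k * w ^ k) = 0"
  obtains g D where "\<And>k. norm (g k) \<le> D * q ^ k" "g 0 = - f 0 / w"
    "(\<Sum>k. (norm (g k))\<^sup>2) = (\<Sum>k. (norm (f k))\<^sup>2)"
    "\<And>z. norm z \<le> 1 \<Longrightarrow> (z - w) * (\<Sum>k. g k * z ^ k) = (1 - cnj w * z) * (\<Sum>k. f k * z ^ k)"
proof -
  have C: "0 \<le> C"
    using order_trans[OF norm_ge_zero bound[of 0]] by simp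
  \<comment> \<open>Synthetic division: \<open>h\<close> holds the coefficients of the quotient by
    \<open>z - w\<close>, and \<open>h'\<close> those of \<open>z\<close> times that
    quotient.\<close>
  define h where "h k = (\<Sum>j. f (j + Suc k) * w ^ j)" for k
  define h' where "h' k = (case k of 0 \<Rightarrow> 0 | Suc m \<Rightarrow> h m)" for k
  define H where "H = C / (1 - q)"
  have H: "0 \<le> H" using C q by (simp add: H_def)
  have term_bound: "norm (f (j + k) * w ^ j) \<le> C * q ^ k * q ^ j" for j k
  proof -
    have "norm (f (j + k) * w ^ j) \<le> (C * q ^ (j + k)) * 1"
      unfolding norm_mult norm_power using w
      by (intro mult_mono power_le_one bound) (auto intro: order_trans[OF norm_ge_zero bound])
    then show ?thesis by (simp add: power_add mult_ac)
  qed
  have sum_tail: "summable (\<lambda>j. f (j + k) * w ^ j)" for k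
    by (rule summable_comparison_test'[OF _ term_bound])
       (use q in \<open>auto intro!: summable_mult summable_geometric\<close>)
  have tail_bound: "norm (\<Sum>j. f (j + k) * w ^ j) \<le> H * q ^ k" for k
  proof -
    have sm: "summable (\<lambda>j. C * q ^ k * q ^ j)"
      using q by (auto intro!: summable_mult summable_geometric)
    have "norm (\<Sum>j. f (j + k) * w ^ j) \<le> (\<Sum>j. C * q ^ k * q ^ j)"
      by (rule norm_suminf_le[OF term_bound sm])
    also have "\<dots> = H * q ^ k"
      using q by (subst suminf_mult) (auto simp: suminf_geometric H_def intro!: summable_geometric)
    finally show ?thesis .
  qed
  have h_bound: "norm (h k) \<le> H * q ^ k" for k
  proof -
    have "norm (h k) \<le> H * q ^ Suc k"
      unfolding h_def by (rule tail_bound)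
    also have "\<dots> \<le> H * q ^ k"
      using H q by (intro mult_left_mono power_decreasing) auto
    finally show ?thesis .
  qed
  have h'_bound: "norm (h' k) \<le> H * q ^ k" for k
    using tail_bound[of k] H by (cases k) (simp_all add: h'_def h_def)
  have split: "(\<Sum>j. f (j + k) * w ^ j) = f k + w * h k" for k
    using suminf_split_head[OF sum_tail[of k]] suminf_mult[OF sum_tail[of "Suc k"], of w]
    by (simp add: h_def algebra_simps)
  \<comment> \<open>Coefficient form of multiplying the quotient by \<open>z - w\<close>. The zero
    at \<open>w\<close> enters at \<open>k = 0\<close>, where it makes the remainder vanish.\<close>
  have f_eq: "f k = h' k - w * h k" for k
  proof (cases k)
    case 0
    then show ?thesis using split[of 0] zero by (simp add: h'_def eq_neg_iff_add_eq_0)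
  next
    case (Suc m)
    then show ?thesis using split[of k] by (simp add: h'_def h_def)
  qed
  define g where "g k = h k - cnj w * h' k" for k
  have g_bound: "norm (g k) \<le> (2 * H) * q ^ k" for k
  proof -
    have "norm (g k) \<le> norm (h k) + norm (cnj w * h' k)"
      unfolding g_def by (rule norm_triangle_ineq4)
    also have "\<dots> \<le> H * q ^ k + 1 * (H * q ^ k)"
      unfolding norm_mult using w h_bound h'_bound H q by (intro add_mono mult_mono) auto
    finally show ?thesis by simp
  qed
  have g0: "g 0 = - f 0 / w"
    using f_eq[of 0] w by (simp add: g_def h'_def)
  note sq = summable_norm_square_geometric_bound[OF q]
  \<comment> \<open>\<open>h'\<close> is \<open>h\<close> with a zero put in front, so the two l2
    norms agree.\<close>
  have sums_eq: "(\<Sum>k. (norm (h' k))\<^sup>2) = (\<Sum>k. (norm (h k))\<^sup>2)"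
    using suminf_split_head[OF sq[OF h'_bound]] by (simp add: h'_def)
  have "(\<Sum>k. (norm (f k))\<^sup>2) - (\<Sum>k. (norm (g k))\<^sup>2) = (\<Sum>k. (norm (f k))\<^sup>2 - (norm (g k))\<^sup>2)"
    by (rule suminf_diff[OF sq[OF bound] sq[OF g_bound]])
  also have "\<dots> = (\<Sum>k. (1 - (norm w)\<^sup>2) * ((norm (h' k))\<^sup>2 - (norm (h k))\<^sup>2))"
    by (simp add: f_eq g_def cmod_Blaschke_swap)
  also have "\<dots> = (1 - (norm w)\<^sup>2) * (\<Sum>k. (norm (h' k))\<^sup>2 - (norm (h k))\<^sup>2)"
    by (intro suminf_mult summable_diff sq[OF h'_bound] sq[OF h_bound])
  also have "(\<Sum>k. (norm (h' k))\<^sup>2 - (norm (h k))\<^sup>2) = 0"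
    using suminf_diff[OF sq[OF h'_bound] sq[OF h_bound]] sums_eq by simp
  finally have norms: "(\<Sum>k. (norm (g k))\<^sup>2) = (\<Sum>k. (norm (f k))\<^sup>2)" by simp
  have "(z - w) * (\<Sum>k. g k * z ^ k) = (1 - cnj w * z) * (\<Sum>k. f k * z ^ k)" if z: "norm z \<le> 1" for z
  proof -
    note sm = summable_power_series_geometric_bound[OF q _ z]
    define S where "S = (\<Sum>k. h k * z ^ k)"
    have S': "(\<Sum>k. h' k * z ^ k) = z * S"
      using suminf_split_head[OF sm[OF h'_bound]] suminf_mult[OF sm[OF h_bound], of z]
      by (simp add: h'_def S_def mult_ac)
    have "(\<Sum>k. f k * z ^ k) = (\<Sum>k. h' k * z ^ k - w * (h k * z ^ k))"
      by (simp add: f_eq algebra_simps)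
    also have "\<dots> = z * S - w * S"
      using suminf_diff[OF sm[OF h'_bound] summable_mult[OF sm[OF h_bound], of w]]
        suminf_mult[OF sm[OF h_bound], of w]
      by (simp add: S' S_def)
    finally have F: "(\<Sum>k. f k * z ^ k) = z * S - w * S" .
    have "(\<Sum>k. g k * z ^ k) = (\<Sum>k. h k * z ^ k - cnj w * (h' k * z ^ k))"
      by (simp add: g_def algebra_simps)
    also have "\<dots> = S - cnj w * (z * S)"
      using suminf_diff[OF sm[OF h_bound] summable_mult[OF sm[OF h'_bound], of "cnj w"]]
        suminf_mult[OF sm[OF h'_bound], of "cnj w"]
      by (simp add: S' S_def)
    finally have G: "(\<Sum>k. g k * z ^ k) = S - cnj w * (z * S)" .
    show ?thesis unfolding F G by (simp add: algebra_simps)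
  qed
  then show thesis using that[OF g_bound g0 norms] by blast
qed

lemma power_series_differentiable:
  fixes f :: "nat \<Rightarrow> complex"
  assumes q: "0 \<le> q" "q < 1" and bound: "\<And>k. norm (f k) \<le> C * q ^ k" and z: "norm z < 1"
  shows "\<exists>D. ((\<lambda>z. \<Sum>k. f k * z ^ k) has_field_derivative D) (at z)"
proof -
  have "summable (\<lambda>k. f k * 1 ^ k)"
    by (rule summable_power_series_geometric_bound[OF q bound]) simp
  from termdiffs_strong[OF this, of z] z show ?thesis by auto
qed

text \<open>One division lowers the order of the zero at \<open>w\<close> by one: the derivative at
  \<open>w\<close> is \<open>G w\<close> on the left of \<open>eq\<close> and 0 on the
  right.\<close>

lemma Blaschke_quotient_zero:
  fixes F G :: "complex \<Rightarrow> complex"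
  assumes eq: "\<And>z. norm z \<le> 1 \<Longrightarrow> (z - w) * G z = (1 - cnj w * z) * F z"
    and w: "norm w < 1" and F: "F w = 0" "(F has_field_derivative 0) (at w)"
    and G: "\<exists>D. (G has_field_derivative D) (at w)"
  shows "G w = 0"
proof -
  obtain D where D: "(G has_field_derivative D) (at w)" using G by blast
  have 1: "((\<lambda>z. (z - w) * G z) has_field_derivative G w) (at w)"
    by (rule derivative_eq_intros D refl | simp)+
  have "((\<lambda>z. (1 - cnj w * z) * F z) has_field_derivative 0) (at w)"
    by (rule derivative_eq_intros F refl | simp add: F)+
  then have "((\<lambda>z. (z - w) * G z) has_field_derivative 0) (at w)"
    by (rule has_field_derivative_transform_within_open[of _ _ _ "ball 0 1"]) (use w eq in auto)
  with 1 show ?thesis by (rule DERIV_unique)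
qed

text \<open>Near \<open>u\<close> the quotient is \<open>F\<close> times a differentiable factor, so
  a double zero away from \<open>w\<close> survives the division.\<close>

lemma Blaschke_quotient_double_zero:
  fixes F G :: "complex \<Rightarrow> complex"
  assumes eq: "\<And>z. norm z \<le> 1 \<Longrightarrow> (z - w) * G z = (1 - cnj w * z) * F z"
    and u: "norm u < 1" "u \<noteq> w" and F: "F u = 0" "(F has_field_derivative 0) (at u)"
  shows "G u = 0" "(G has_field_derivative 0) (at u)"
proof -
  show "G u = 0" using eq[of u] u F by simp
  have "((\<lambda>z. (1 - cnj w * z) * F z / (z - w)) has_field_derivative 0) (at u)"
    by (rule derivative_eq_intros F refl | simp add: F u)+
  then show "(G has_field_derivative 0) (at u)"
  proof (rule has_field_derivative_transform_within_open[of _ _ _ "ball 0 1 - {w}"])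
    fix z assume "z \<in> ball 0 1 - {w}"
    then show "(1 - cnj w * z) * F z / (z - w) = G z"
      using eq[of z] by (auto simp: field_simps)
  qed (use u in auto)
qed

text \<open>
  Dividing out the Blaschke factors of the four zeros \<open>w, w, cnj w, cnj w\<close> preserves the
  \<open>\<ell>\<^sup>2\<close> norm of the coefficients and multiplies the constant term by a number of modulus
  \<open>norm w powr (- 4)\<close>.
\<close>

lemma conjugate_double_zeros_l2_bound:
  fixes f :: "nat \<Rightarrow> complex"
  assumes q: "0 \<le> q" "q < 1" and bound: "\<And>k. norm (f k) \<le> C * q ^ k"
    and w: "norm w < 1" "w \<notin> \<real>"
    and zw: "(\<Sum>k. f k * w ^ k) = 0" "((\<lambda>z. \<Sum>k. f k * z ^ k) has_field_derivative 0) (at w)"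
    and zc: "(\<Sum>k. f k * cnj w ^ k) = 0" "((\<lambda>z. \<Sum>k. f k * z ^ k) has_field_derivative 0) (at (cnj w))"
  shows "(norm (f 0))\<^sup>2 \<le> norm w ^ 8 * (\<Sum>k. (norm (f k))\<^sup>2)"
proof -
  have w0: "w \<noteq> 0" "cnj w \<noteq> 0" and wc: "cnj w \<noteq> w" using w(2) by (auto simp: Reals_cnj_iff)
  have cw: "norm (cnj w) < 1" using w by simp
  define PS where "PS f z = (\<Sum>k. f k * z ^ k)" for f :: "nat \<Rightarrow> complex" and z
  note fold = PS_def[symmetric]
  note div = Blaschke_division[OF q, folded PS_def]
  note diff = power_series_differentiable[OF q, folded PS_def]
  note zw = zw[unfolded fold] and zc = zc[unfolded fold]
  obtain g1 D1 where g1: "\<And>k. norm (g1 k) \<le> D1 * q ^ k" "g1 0 = - f 0 / w"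
    "(\<Sum>k. (norm (g1 k))\<^sup>2) = (\<Sum>k. (norm (f k))\<^sup>2)"
    "\<And>z. norm z \<le> 1 \<Longrightarrow> (z - w) * PS g1 z = (1 - cnj w * z) * PS f z"
    by (rule div[OF bound w(1) w0(1) zw(1)], rule that)
  \<comment> \<open>The first division uses up one order of the zero at \<open>w\<close>; the
    remaining order permits the second division by the same factor.\<close>
  have z1: "PS g1 w = 0"
    using Blaschke_quotient_zero[OF g1(4) w(1) zw] diff[OF g1(1) w(1)] by blast
  have d1: "PS g1 (cnj w) = 0" "(PS g1 has_field_derivative 0) (at (cnj w))"
    using Blaschke_quotient_double_zero[OF g1(4) cw wc zc] by blast+
  obtain g2 D2 where g2: "\<And>k. norm (g2 k) \<le> D2 * q ^ k" "g2 0 = - g1 0 / w"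
    "(\<Sum>k. (norm (g2 k))\<^sup>2) = (\<Sum>k. (norm (g1 k))\<^sup>2)"
    "\<And>z. norm z \<le> 1 \<Longrightarrow> (z - w) * PS g2 z = (1 - cnj w * z) * PS g1 z"
    by (rule div[OF g1(1) w(1) w0(1) z1], rule that)
  have d2: "PS g2 (cnj w) = 0" "(PS g2 has_field_derivative 0) (at (cnj w))"
    using Blaschke_quotient_double_zero[OF g2(4) cw wc d1] by blast+
  obtain g3 D3 where g3: "\<And>k. norm (g3 k) \<le> D3 * q ^ k" "g3 0 = - g2 0 / cnj w"
    "(\<Sum>k. (norm (g3 k))\<^sup>2) = (\<Sum>k. (norm (g2 k))\<^sup>2)"
    "\<And>z. norm z \<le> 1 \<Longrightarrow> (z - cnj w) * PS g3 z = (1 - cnj (cnj w) * z) * PS g2 z"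
    by (rule div[OF g2(1) cw w0(2) d2(1)], rule that)
  have z3: "PS g3 (cnj w) = 0"
    using Blaschke_quotient_zero[OF g3(4) cw d2] diff[OF g3(1) cw] by blast
  obtain g4 D4 where g4: "\<And>k. norm (g4 k) \<le> D4 * q ^ k" "g4 0 = - g3 0 / cnj w"
    "(\<Sum>k. (norm (g4 k))\<^sup>2) = (\<Sum>k. (norm (g3 k))\<^sup>2)"
    by (rule div[OF g3(1) cw w0(2) z3], rule that)
  \<comment> \<open>The constant term of the last quotient is bounded by the l2 norm, which all four
    divisions have left unchanged.\<close>
  have "(norm (g4 0))\<^sup>2 \<le> (\<Sum>k. (norm (g4 k))\<^sup>2)"
    using sum_le_suminf[OF summable_norm_square_geometric_bound[OF q g4(1)], of "{0}"] by simp
  moreover have "norm (g4 0) = norm (f 0) / norm w ^ 4"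
    by (simp add: g4(2) g3(2) g2(2) g1(2) norm_divide norm_mult eval_nat_numeral)
  ultimately have "(norm (f 0) / norm w ^ 4)\<^sup>2 \<le> (\<Sum>k. (norm (f k))\<^sup>2)"
    by (simp add: g4(3) g3(3) g2(3) g1(3))
  then show ?thesis
    using w0 by (simp add: power_divide field_simps power_mult[symmetric])
qed

section \<open>Power series with real coefficients in [-1, 1]\<close>

definition rps :: "(nat \<Rightarrow> real) \<Rightarrow> complex \<Rightarrow> complex" where
  "rps a z = (\<Sum>k. of_real (a k) * z ^ k)"

text \<open>The termwise derivative. At \<open>k = 0\<close> the exponent \<open>k - 1\<close> is
  truncated to 0, but the factor \<open>of_nat k\<close> removes that term.\<close>

definition rps' :: "(nat \<Rightarrow> real) \<Rightarrow> complex \<Rightarrow> complex" where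
  "rps' a z = (\<Sum>k. of_nat k * of_real (a k) * z ^ (k - 1))"

text \<open>The radius \<open>q\<close> is kept apart from \<open>norm z\<close> so that the bound
  serves both for summability at one point and as a majorant in the Weierstrass test.\<close>

lemma rps_term_bound:
  fixes z :: complex
  assumes "\<bar>a\<bar> \<le> 1" and "norm z \<le> q"
  shows "norm (of_real a * z ^ k) \<le> q ^ k"
proof -
  have "norm (of_real a * z ^ k) \<le> 1 * q ^ k"
    unfolding norm_mult norm_power using assms by (intro mult_mono power_mono) auto
  then show ?thesis by simp
qed

lemma rps'_term_bound:
  fixes z :: complex
  assumes "\<bar>a\<bar> \<le> 1" and "norm z \<le> q"
  shows "norm (of_nat k * of_real a * z ^ (k - 1)) \<le> real k * q ^ (k - 1)"
proof -
  have "norm (of_nat k * of_real a * z ^ (k - 1)) \<le> real k * 1 * q ^ (k - 1)"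
    unfolding norm_mult norm_power using assms by (intro mult_mono power_mono) auto
  then show ?thesis by simp
qed

text \<open>These are the first and second formal derivatives of the geometric series, with the
  index shifted back.\<close>

lemma summable_of_nat_power:
  fixes q :: real
  assumes "\<bar>q\<bar> < 1"
  shows "summable (\<lambda>k. real k * q ^ (k - 1))"
    and "summable (\<lambda>k. real k * real (k - 1) * q ^ (k - 2))"
proof -
  have s: "summable (\<lambda>k. (1::real) * y ^ k)" if "norm y < 1" for y :: real
    using that by (auto intro: summable_geometric)
  have 1: "summable (\<lambda>k. diffs (\<lambda>_. 1) k * y ^ k)" if "norm y < 1" for y :: real
    by (rule termdiff_converges[OF that s])
  then show "summable (\<lambda>k. real k * q ^ (k - 1))"
    using assms by (subst summable_Suc_iff[symmetric]) (simp add: diffs_def)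
  have "summable (\<lambda>k. diffs (diffs (\<lambda>_. 1)) k * q ^ k)"
    using assms by (intro termdiff_converges[OF _ 1, of q 1]) auto
  then show "summable (\<lambda>k. real k * real (k - 1) * q ^ (k - 2))"
    by (subst summable_Suc_iff[symmetric], subst summable_Suc_iff[symmetric])
       (simp add: diffs_def mult_ac)
qed

lemma summable_rps:
  assumes "\<And>k. \<bar>a k\<bar> \<le> 1" and "norm z < 1"
  shows "summable (\<lambda>k. complex_of_real (a k) * z ^ k)"
  by (rule summable_comparison_test'[OF summable_geometric, of "norm z"])
     (use assms in \<open>auto intro: rps_term_bound[THEN order_trans]\<close>)

lemma summable_rps':
  assumes "\<And>k. \<bar>a k\<bar> \<le> 1" and "norm z < 1"
  shows "summable (\<lambda>k. of_nat k * complex_of_real (a k) * z ^ (k - 1))"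
proof (rule summable_comparison_test')
  show "summable (\<lambda>k. real k * norm z ^ (k - 1))"
    using assms by (intro summable_of_nat_power(1)) auto
  show "norm (of_nat k * complex_of_real (a k) * z ^ (k - 1)) \<le> real k * norm z ^ (k - 1)" for k
    using assms by (intro rps'_term_bound) auto
qed

lemma rps_has_field_derivative:
  assumes a: "\<And>k. \<bar>a k\<bar> \<le> 1" and z: "norm z < 1"
  shows "(rps a has_field_derivative rps' a z) (at z)"
proof -
  have s: "summable (\<lambda>k. complex_of_real (a k) * y ^ k)" if "norm y < 1" for y
    using a that by (rule summable_rps)
  have 1: "(rps a has_field_derivative (\<Sum>k. diffs (\<lambda>k. of_real (a k)) k * z ^ k)) (at z)"
    unfolding rps_def by (rule termdiffs_strong'[OF s z])
  from suminf_split_head[OF summable_rps'[OF assms]]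
  have "(\<Sum>k. diffs (\<lambda>k. of_real (a k)) k * z ^ k) = rps' a z"
    by (simp add: rps'_def diffs_def)
  with 1 show ?thesis by simp
qed

text \<open>Conjugation fixes the real coefficients. Together with the same fact for
  \<open>rps'\<close>, this turns a nonreal double zero into a conjugate pair of double
  zeros.\<close>

lemma rps_cnj: "rps a (cnj z) = cnj (rps a z)" if "\<And>k. \<bar>a k\<bar> \<le> 1" "norm z < 1"
proof -
  have "(\<lambda>k. of_real (a k) * z ^ k) sums rps a z"
    unfolding rps_def using summable_rps[OF that] by (rule summable_sums)
  then have "(\<lambda>k. cnj (of_real (a k) * z ^ k)) sums cnj (rps a z)"
    by (rule sums_cnj[THEN iffD2])
  then show ?thesis
    by (simp add: rps_def sums_iff)
qed

lemma rps'_cnj: "rps' a (cnj z) = cnj (rps' a z)" if "\<And>k. \<bar>a k\<bar> \<le> 1" "norm z < 1"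
proof -
  have "(\<lambda>k. of_nat k * of_real (a k) * z ^ (k - 1)) sums rps' a z"
    unfolding rps'_def using summable_rps'[OF that] by (rule summable_sums)
  then have "(\<lambda>k. cnj (of_nat k * of_real (a k) * z ^ (k - 1))) sums cnj (rps' a z)"
    by (rule sums_cnj[THEN iffD2])
  then show ?thesis
    by (simp add: rps'_def sums_iff)
qed

lemma rps_no_nonreal_double_zero:
  assumes a: "\<And>k. \<bar>a k\<bar> \<le> 1" and a0: "a 0 = 1"
    and z: "norm z < 2 * 5 powr (- 5 / 8)" "z \<notin> \<real>"
    and zero: "rps a z = 0" "rps' a z = 0"
  shows False
proof -
  \<comment> \<open>\<open>R\<^sup>2 = 4 / 5\<close> maximises
    \<open>R ^ 8 * (1 - R\<^sup>2)\<close>; the maximum \<open>256 / 3125\<close> is the eighth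
    power of the radius of \<open>param_U\<close>.\<close>
  define R :: real where "R = 2 / sqrt 5"
  define f where "f k = complex_of_real (a k * R ^ k)" for k
  have R: "0 < R" "R < 1" "R\<^sup>2 = 4 / 5"
    by (auto simp: R_def power_divide real_less_rsqrt)
  have "norm z ^ 8 < (2 * 5 powr (- 5 / 8)) ^ 8"
    using z(1) by (intro power_strict_mono) auto
  also have "\<dots> = 256 / 3125"
    by (simp add: power_mult_distrib powr_realpow[symmetric] powr_powr powr_minus field_simps)
  finally have z8: "norm z ^ 8 < 256 / 3125" .
  have "R ^ 8 = (R\<^sup>2) ^ 4" by (simp add: power_mult[symmetric])
  then have R8: "R ^ 8 = 256 / 625" by (simp add: R(3) power_divide)
  have "norm z ^ 8 < R ^ 8" using z8 R8 by simp
  then have zR: "norm z < R" using R by (auto intro: power_less_imp_less_base)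
  have z1: "norm z < 1" using zR R by simp
  have bound: "norm (f k) \<le> 1 * R ^ k" for k
  proof -
    have "norm (f k) = \<bar>a k\<bar> * R ^ k" using R by (simp add: f_def norm_mult norm_power abs_mult)
    also have "\<dots> \<le> 1 * R ^ k" using a R by (intro mult_right_mono) auto
    finally show ?thesis .
  qed
  have f_rps: "(\<lambda>x. \<Sum>k. f k * x ^ k) = (\<lambda>x. rps a (of_real R * x))"
    by (simp add: rps_def f_def power_mult_distrib mult_ac)
  \<comment> \<open>The rescaled series has its zeros at \<open>y / R\<close>. The statement is for
    a general \<open>y\<close> because it is applied to \<open>z\<close> and to
    \<open>cnj z\<close>.\<close>
  have double_zero: "(\<Sum>k. f k * u ^ k) = 0"
      "((\<lambda>x. \<Sum>k. f k * x ^ k) has_field_derivative 0) (at u)"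
    if "rps a y = 0" "rps' a y = 0" "norm y < 1" "u = y / of_real R" for y u
  proof -
    have y: "of_real R * u = y" using that R by simp
    show "(\<Sum>k. f k * u ^ k) = 0" using fun_cong[OF f_rps, of u] y that by simp
    have "(rps a has_field_derivative 0) (at (of_real R * u))"
      using rps_has_field_derivative[of a, OF a that(3)] that y by simp
    from DERIV_chain2[where g = "\<lambda>x. of_real R * x" and x = u, OF this, of "of_real R"]
    show "((\<lambda>x. \<Sum>k. f k * x ^ k) has_field_derivative 0) (at u)"
      unfolding f_rps by (auto intro!: derivative_eq_intros)
  qed
  define w where "w = z / of_real R"
  have nw: "norm w = norm z / R" using R by (simp add: w_def norm_divide)
  have "w \<notin> \<real>"
  proof
    assume "w \<in> \<real>"
    then have "of_real R * w \<in> \<real>" by (intro Reals_mult) auto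
    with z(2) R show False by (simp add: w_def)
  qed
  moreover have "norm w < 1" using zR R by (simp add: nw)
  moreover have "rps a (cnj z) = 0" "rps' a (cnj z) = 0"
    using zero rps_cnj[OF a z1] rps'_cnj[OF a z1] by simp_all
  ultimately have l2: "(norm (f 0))\<^sup>2 \<le> norm w ^ 8 * (\<Sum>k. (norm (f k))\<^sup>2)"
    using R z1 zero
    by (intro conjugate_double_zeros_l2_bound[OF _ _ bound] double_zero[of z] double_zero[of "cnj z"])
       (auto simp: w_def)
  \<comment> \<open>Coefficients of modulus at most 1 give the l2 bound
    \<open>1 / (1 - R\<^sup>2) = 5\<close>.\<close>
  have "(\<Sum>k. (norm (f k))\<^sup>2) \<le> (\<Sum>k. (4 / 5) ^ k)"
  proof (rule suminf_le)
    show "summable (\<lambda>k. (norm (f k))\<^sup>2)"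
      using R by (intro summable_norm_square_geometric_bound[OF _ _ bound]) auto
    fix k
    have "(norm (f k))\<^sup>2 \<le> (R ^ k)\<^sup>2" using bound[of k] by (intro power_mono) auto
    then show "(norm (f k))\<^sup>2 \<le> (4 / 5) ^ k"
      by (simp add: R(3)[symmetric] power_mult[symmetric] mult.commute)
  qed (auto intro: summable_geometric)
  also have "\<dots> = 5" by (subst suminf_geometric) auto
  finally have "norm w ^ 8 * (\<Sum>k. (norm (f k))\<^sup>2) \<le> norm w ^ 8 * 5"
    by (rule mult_left_mono) simp
  with l2 have "(norm (f 0))\<^sup>2 \<le> norm w ^ 8 * 5" by (rule order_trans)
  then have "1 \<le> norm w ^ 8 * 5" by (simp add: f_def a0)
  \<comment> \<open>The right-hand side is less than
    \<open>5 * 256 / 3125 = 256 / 625 = R ^ 8\<close>, a contradiction.\<close>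
  then have "R ^ 8 \<le> norm z ^ 8 * 5" using R by (simp add: nw power_divide field_simps)
  with z8 R8 show False by simp
qed

section \<open>Sublevel sets of power series\<close>

text \<open>Joint continuity in the coefficients, under the product topology, and in the variable:
  each partial sum involves finitely many coordinates, and the convergence is uniform.\<close>

lemma continuous_on_rps:
  assumes q: "0 \<le> q" "q < 1"
  shows "continuous_on ({a. \<forall>k. \<bar>a k\<bar> \<le> 1} \<times> cball 0 q) (\<lambda>p. rps (fst p) (snd p))"
    and "continuous_on ({a. \<forall>k. \<bar>a k\<bar> \<le> 1} \<times> cball 0 q) (\<lambda>p. rps' (fst p) (snd p))"
proof -
  let ?S = "{a :: nat \<Rightarrow> real. \<forall>k. \<bar>a k\<bar> \<le> 1} \<times> cball (0 :: complex) q"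
  have coord: "continuous_on ?S (\<lambda>p. fst p k)" for k
    by (rule continuous_on_product_then_coordinatewise) (intro continuous_intros)
  show "continuous_on ?S (\<lambda>p. rps (fst p) (snd p))"
    unfolding rps_def
  proof (rule uniform_limit_theorem)
    show "uniform_limit ?S (\<lambda>n p. \<Sum>k<n. of_real (fst p k) * snd p ^ k)
            (\<lambda>p. \<Sum>k. of_real (fst p k) * snd p ^ k) sequentially"
      by (rule Weierstrass_m_test[OF rps_term_bound summable_geometric]) (use q in auto)
    show "\<forall>\<^sub>F n in sequentially. continuous_on ?S (\<lambda>p. \<Sum>k<n. complex_of_real (fst p k) * snd p ^ k)"
      by (intro always_eventually allI continuous_intros coord)
  qed simp
  show "continuous_on ?S (\<lambda>p. rps' (fst p) (snd p))"
    unfolding rps'_def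
  proof (rule uniform_limit_theorem)
    show "uniform_limit ?S (\<lambda>n p. \<Sum>k<n. of_nat k * of_real (fst p k) * snd p ^ (k - 1))
            (\<lambda>p. \<Sum>k. of_nat k * of_real (fst p k) * snd p ^ (k - 1)) sequentially"
      by (rule Weierstrass_m_test[OF rps'_term_bound summable_of_nat_power(1)]) (use q in auto)
    show "\<forall>\<^sub>F n in sequentially. continuous_on ?S
            (\<lambda>p. \<Sum>k<n. of_nat k * complex_of_real (fst p k) * snd p ^ (k - 1))"
      by (intro always_eventually allI continuous_intros coord)
  qed simp
qed

text \<open>Tychonoff: the set is a product of \<open>{1}\<close> at index 0 and copies of
  \<open>{-1..1}\<close>.\<close>

lemma compact_coefficients: "compact {a :: nat \<Rightarrow> real. a 0 = 1 \<and> (\<forall>k. \<bar>a k\<bar> \<le> 1)}"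
proof -
  let ?I = "\<lambda>k::nat. if k = 0 then {1} else {-1..1::real}"
  have "compactin (product_topology (\<lambda>_. euclidean) UNIV) (Pi\<^sub>E UNIV ?I)"
    by (subst compactin_PiE) auto
  then have "compact (Pi\<^sub>E UNIV ?I)"
    by (simp add: euclidean_product_topology)
  also have "Pi\<^sub>E UNIV ?I = {a. a 0 = 1 \<and> (\<forall>k. \<bar>a k\<bar> \<le> 1)}"
  proof -
    have "x \<in> ?I k \<longleftrightarrow> (k = 0 \<longrightarrow> x = 1) \<and> \<bar>x\<bar> \<le> 1" for x k
      by (auto simp: abs_le_iff)
    then show ?thesis by (auto simp: PiE_iff)
  qed
  finally show ?thesis .
qed

lemma param_bound_less_1: "2 * 5 powr (- 5 / 8) < (1::real)"
proof -
  have "(2 * 5 powr (- 5 / 8)) ^ 8 = (256 / 3125 :: real)"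
    by (simp add: power_mult_distrib powr_realpow[symmetric] powr_powr powr_minus field_simps)
  then have "(2 * 5 powr (- 5 / 8)) ^ 8 < (1 ^ 8 :: real)" by simp
  then show ?thesis by (rule power_less_imp_less_base) simp
qed

lemma subset_param_U_norm_bound:
  assumes "G \<subseteq> param_U"
  obtains q where "0 \<le> q" "q < 1" "G \<subseteq> cball 0 q"
proof (rule that)
  show "2 * 5 powr (- 5 / 8) < (1::real)" by (rule param_bound_less_1)
  show "G \<subseteq> cball 0 (2 * 5 powr (- 5 / 8))" using assms by (auto simp: param_U_def)
qed simp

text \<open>The continuous sum of the two norms attains its minimum on the compact product of
  coefficient sequences and \<open>G\<close>; a minimum of 0 would be a nonreal double zero.\<close>

lemma rps_uniform_lower_bound:
  assumes G: "compact G" "G \<subseteq> param_U"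
  obtains \<delta> where "\<delta> > 0"
    "\<And>a z. a 0 = 1 \<Longrightarrow> (\<And>k. \<bar>a k\<bar> \<le> 1) \<Longrightarrow> z \<in> G \<Longrightarrow> \<delta> \<le> norm (rps a z) + norm (rps' a z)"
proof (cases "G = {}")
  case True
  then show ?thesis using that[of 1] by auto
next
  case False
  obtain q where q: "0 \<le> q" "q < 1" "G \<subseteq> cball 0 q"
    using subset_param_U_norm_bound[OF G(2)] .
  let ?A = "{a :: nat \<Rightarrow> real. a 0 = 1 \<and> (\<forall>k. \<bar>a k\<bar> \<le> 1)}"
  let ?h = "\<lambda>p. norm (rps (fst p) (snd p)) + norm (rps' (fst p) (snd p))"
  have cont: "continuous_on (?A \<times> G) ?h"
    by (intro continuous_intros continuous_on_rps[OF q(1,2), THEN continuous_on_subset])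
       (use q in auto)
  have 1: "compact (?A \<times> G)"
    by (intro compact_Times compact_coefficients G)
  have 2: "?A \<times> G \<noteq> {}"
    using False by (auto intro: exI[of _ "\<lambda>_. 1"])
  obtain p where p: "p \<in> ?A \<times> G" "\<And>x. x \<in> ?A \<times> G \<Longrightarrow> ?h p \<le> ?h x"
    using continuous_attains_inf[OF 1 2 cont] by blast
  have "?h p \<noteq> 0"
  proof
    assume "?h p = 0"
    then have "rps (fst p) (snd p) = 0" "rps' (fst p) (snd p) = 0"
      by (simp_all add: add_nonneg_eq_0_iff)
    then show False
      using p(1) G rps_no_nonreal_double_zero[of "fst p" "snd p"] by (auto simp: param_U_def)
  qed
  moreover have "0 \<le> ?h p" by simp
  ultimately have "0 < ?h p" by linarith
  then show thesis
  proof (rule that)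
    fix a :: "nat \<Rightarrow> real" and z
    assume "a 0 = 1" "\<And>k. \<bar>a k\<bar> \<le> 1" "z \<in> G"
    then show "?h p \<le> norm (rps a z) + norm (rps' a z)"
      using p(2)[of "(a, z)"] by simp
  qed
qed

text \<open>First-order Taylor expansion. \<open>M\<close> does not depend on the coefficients,
  since the second derivative of every such series is dominated by that of the geometric series at
  \<open>q\<close>.\<close>

lemma rps_quadratic_remainder:
  assumes q: "0 \<le> q" "q < 1"
  obtains M where "M > 0"
    "\<And>a x y. (\<And>k. \<bar>a k\<bar> \<le> 1) \<Longrightarrow> norm x \<le> q \<Longrightarrow> norm y \<le> q \<Longrightarrow>
       norm (rps a y - rps a x - rps' a x * (y - x)) \<le> M * (norm (y - x))\<^sup>2"
proof -
  define M where "M = (\<Sum>k. real k * real (k - 1) * q ^ (k - 2))"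
  have sM: "summable (\<lambda>k. real k * real (k - 1) * q ^ (k - 2))"
    using q by (intro summable_of_nat_power(2)) auto
  have M0: "0 \<le> M"
    unfolding M_def using q by (intro suminf_nonneg sM) auto
  have "norm (rps a y - rps a x - rps' a x * (y - x)) \<le> (M + 1) * (norm (y - x))\<^sup>2"
    if a: "\<And>k. \<bar>a k\<bar> \<le> 1" and x: "norm x \<le> q" and y: "norm y \<le> q" for a x y
  proof -
    \<comment> \<open>\<open>f i\<close> is the \<open>i\<close>-th derivative of
      \<open>rps a\<close>, obtained by formal differentiation as the Taylor theorem
      expects.\<close>
    define f where "f i z = (\<Sum>k. (diffs ^^ i) (\<lambda>k. complex_of_real (a k)) k * z ^ k)" for i :: nat and z
    have s: "summable (\<lambda>k. (diffs ^^ i) (\<lambda>k. complex_of_real (a k)) k * z ^ k)" if "norm z < 1" for i z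
      using that
    proof (induction i arbitrary: z)
      case 0
      then show ?case using summable_rps[of a z] a by simp
    next
      case (Suc i)
      then show ?case using termdiff_converges[of z 1] by simp
    qed
    have df: "(f i has_field_derivative f (Suc i) z) (at z)" if "norm z < 1" for i z
      using termdiffs_strong'[of 1 "(diffs ^^ i) (\<lambda>k. complex_of_real (a k))", OF s that]
      by (simp add: f_def[abs_def])
    have f0: "f 0 = rps a" by (rule ext) (simp add: f_def rps_def)
    have f1: "f 1 z = rps' a z" if "norm z < 1" for z
      using DERIV_unique[OF df[OF that, of 0] rps_has_field_derivative[of a, OF a that, folded f0]] by simp
    have f2: "norm (f 2 z) \<le> M + 1" if z: "norm z \<le> q" for z
    proof -
      have "norm (f 2 z) \<le> (\<Sum>k. real (Suc (Suc k)) * real (Suc k) * q ^ k)"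
        unfolding f_def
      proof (rule norm_suminf_le)
        show "summable (\<lambda>k. real (Suc (Suc k)) * real (Suc k) * q ^ k)"
          using sM[folded summable_Suc_iff[of "\<lambda>k. real k * real (k - 1) * q ^ (k - 2)"],
              folded summable_Suc_iff[of "\<lambda>k. real (Suc k) * real (Suc k - 1) * q ^ (Suc k - 2)"]]
          by simp
        fix k
        have "norm ((diffs ^^ 2) (\<lambda>k. complex_of_real (a k)) k * z ^ k)
            = real (Suc (Suc k)) * real (Suc k) * \<bar>a (Suc (Suc k))\<bar> * norm z ^ k"
          by (simp add: numeral_2_eq_2 diffs_def norm_mult norm_power del: of_nat_Suc)
        also have "\<dots> \<le> real (Suc (Suc k)) * real (Suc k) * 1 * q ^ k"
          using a z by (intro mult_mono power_mono) auto
        finally show "norm ((diffs ^^ 2) (\<lambda>k. complex_of_real (a k)) k * z ^ k)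
            \<le> real (Suc (Suc k)) * real (Suc k) * q ^ k" by simp
      qed
      \<comment> \<open>The first two terms of the series for \<open>M\<close> vanish, so starting
        two places later leaves the sum unchanged.\<close>
      also have "\<dots> = M"
        using suminf_split_initial_segment[OF sM, of 2] by (simp add: M_def numeral_2_eq_2)
      finally show ?thesis by simp
    qed
    \<comment> \<open>The expansion takes place in the convex disc \<open>cball 0 q\<close>, which
      contains both points and lies inside the open unit disc.\<close>
    have "norm (f 0 y - (\<Sum>i\<le>1. f i x * (y - x) ^ i / fact i)) \<le> (M + 1) * norm (y - x) ^ Suc 1 / fact 1"
    proof (rule complex_Taylor[where S = "cball 0 q"])
      show "cmod (f (Suc 1) z) \<le> M + 1" if "z \<in> cball 0 q" for z
        using f2[of z] that by (simp add: numeral_2_eq_2)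
      show "(f i has_field_derivative f (Suc i) z) (at z within cball 0 q)" if "z \<in> cball 0 q" for i z
        by (rule has_field_derivative_at_within, rule df) (use that q in auto)
    qed (use x y in auto)
    then show ?thesis
      using f0 f1[of x] x q by (simp add: algebra_simps power2_eq_square)
  qed
  then show thesis using that[of "M + 1"] M0 by auto
qed

lemma emeasure_lebesgue_cball:
  assumes "0 \<le> r"
  shows "emeasure lebesgue (cball (c :: complex) r) = ennreal (unit_ball_vol 2 * r\<^sup>2)"
  using emeasure_cball[OF assms, of c] by simp

text \<open>For small \<open>r\<close> the derivative is bounded below on the sublevel set, so
  within each small ball two of its points are at distance at most \<open>8 * r / \<delta>\<close>.
  Finitely many balls, their number independent of \<open>a\<close> and \<open>r\<close>, cover
  \<open>G\<close>.\<close>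

lemma rps_sublevel_measure:
  assumes G: "compact G" "G \<subseteq> param_U"
  obtains C where "C > 0"
    "\<And>a r. a 0 = 1 \<Longrightarrow> (\<And>k. \<bar>a k\<bar> \<le> 1) \<Longrightarrow> 0 < r \<Longrightarrow>
       emeasure lebesgue {t \<in> G. norm (rps a t) \<le> r} \<le> ennreal (C * r\<^sup>2)"
proof -
  obtain q where q: "0 \<le> q" "q < 1" "G \<subseteq> cball 0 q"
    using subset_param_U_norm_bound[OF G(2)] .
  obtain \<delta> where \<delta>: "\<delta> > 0"
    "\<And>a z. a 0 = 1 \<Longrightarrow> (\<And>k. \<bar>a k\<bar> \<le> 1) \<Longrightarrow> z \<in> G \<Longrightarrow> \<delta> \<le> norm (rps a z) + norm (rps' a z)"
    using rps_uniform_lower_bound[OF G] by blast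
  obtain M where M: "M > 0"
    "\<And>a x y. (\<And>k. \<bar>a k\<bar> \<le> 1) \<Longrightarrow> norm x \<le> q \<Longrightarrow> norm y \<le> q \<Longrightarrow>
       norm (rps a y - rps a x - rps' a x * (y - x)) \<le> M * (norm (y - x))\<^sup>2"
    using rps_quadratic_remainder[OF q(1,2)] by blast
  \<comment> \<open>Two points of one ball are less than \<open>2 * s\<close> apart, which makes the
    quadratic remainder at most half of the linear lower bound
    \<open>\<delta> / 2 * norm (y - x)\<close>.\<close>
  define s where "s = \<delta> / (8 * M)"
  have s: "0 < s" using \<delta> M by (simp add: s_def)
  obtain T where T: "finite T" "G \<subseteq> (\<Union>x\<in>T. ball x s)"
    by (rule compactE_image[OF G(1), of G "\<lambda>x. ball x s"]) (use s in auto)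
  define \<beta> where "\<beta> = unit_ball_vol (2::real)"
  have \<beta>: "0 < \<beta>" by (simp add: \<beta>_def)
  \<comment> \<open>The summand 1 keeps \<open>C\<close> positive when \<open>T\<close> is empty and
    covers large \<open>r\<close>, where the area of the unit disc is the bound.\<close>
  define C where "C = (real (card T) + 1) * \<beta> * (8 / \<delta>)\<^sup>2"
  show thesis
  proof (rule that)
    show "C > 0" using \<beta> \<delta> by (simp add: C_def add_nonneg_pos)
    fix a :: "nat \<Rightarrow> real" and r :: real
    assume a: "a 0 = 1" "\<And>k. \<bar>a k\<bar> \<le> 1" and r: "0 < r"
    define S where "S = {t \<in> G. norm (rps a t) \<le> r}"
    have "emeasure lebesgue S \<le> ennreal (C * r\<^sup>2)"
    proof (cases "r < \<delta> / 2")
      case False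
      have "emeasure lebesgue S \<le> emeasure lebesgue (cball (0::complex) 1)"
        by (rule emeasure_mono) (use q in \<open>auto simp: S_def\<close>)
      also have "\<dots> = ennreal (\<beta> * 1)"
        by (subst emeasure_lebesgue_cball) (auto simp: \<beta>_def)
      also have "\<dots> \<le> ennreal (C * r\<^sup>2)"
      proof (rule ennreal_leI)
        have "1 \<le> 8 / \<delta> * r" using False \<delta> by (simp add: field_simps)
        then have "1 \<le> (8 / \<delta> * r)\<^sup>2" by simp
        then have "1 * (\<beta> * 1) \<le> (real (card T) + 1) * (\<beta> * (8 / \<delta> * r)\<^sup>2)"
          using \<beta> by (intro mult_mono) auto
        then show "\<beta> * 1 \<le> C * r\<^sup>2"
          by (simp only: C_def power_mult_distrib mult_ac mult_1_left mult_1_right)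
      qed
      finally show ?thesis .
    next
      case True
      have close: "norm (y - x) \<le> 8 * r / \<delta>"
        if x: "x \<in> S" "x \<in> ball c s" and y: "y \<in> S" "y \<in> ball c s" for x y c
      proof -
        have "dist x y < 2 * s"
          using dist_triangle2[of x y c] x(2) y(2) by (simp add: dist_commute)
        then have "norm (y - x) \<le> 2 * s" by (simp add: dist_norm norm_minus_commute)
        then have "M * norm (y - x) \<le> M * (2 * s)" using M(1) by (intro mult_left_mono) auto
        also have "\<dots> = \<delta> / 4" using M(1) by (simp add: s_def)
        finally have "M * norm (y - x) \<le> \<delta> / 4" .
        from mult_right_mono[OF this norm_ge_zero[of "y - x"]]
        have quad: "M * (norm (y - x))\<^sup>2 \<le> \<delta> / 4 * norm (y - x)"
          by (simp only: power2_eq_square mult.assoc)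
        have f: "norm (rps a x) \<le> r" "norm (rps a y) \<le> r" using x y by (auto simp: S_def)
        have xG: "x \<in> G" "y \<in> G" using x y by (auto simp: S_def)
        have "\<delta> \<le> norm (rps a x) + norm (rps' a x)"
          by (rule \<delta>(2)[of a, OF a xG(1)])
        then have "\<delta> / 2 \<le> norm (rps' a x)"
          using f(1) True by linarith
        from mult_right_mono[OF this norm_ge_zero[of "y - x"]]
        have "\<delta> / 2 * norm (y - x) \<le> norm (rps' a x * (y - x))"
          by (simp only: norm_mult)
        also have "\<dots> \<le> norm (rps a y - rps a x) + norm (rps a y - rps a x - rps' a x * (y - x))"
          using norm_triangle_sub[of "rps' a x * (y - x)" "rps a y - rps a x"]
          by (simp add: norm_minus_commute)
        also have "\<dots> \<le> 2 * r + \<delta> / 4 * norm (y - x)"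
        proof (rule add_mono)
          show "norm (rps a y - rps a x) \<le> 2 * r"
            using norm_triangle_ineq4[of "rps a y" "rps a x"] f by linarith
          have "norm x \<le> q" "norm y \<le> q" using xG q(3) by auto
          from order_trans[OF M(2)[of a x y, OF a(2) this] quad]
          show "norm (rps a y - rps a x - rps' a x * (y - x)) \<le> \<delta> / 4 * norm (y - x)" .
        qed
        finally show ?thesis using \<delta>(1) by (simp add: field_simps)
      qed
      define p where "p c = (SOME x. x \<in> S \<and> x \<in> ball c s)" for c
      have "S \<subseteq> (\<Union>c\<in>T. cball (p c) (8 * r / \<delta>))"
      proof
        fix y assume y: "y \<in> S"
        then obtain c where c: "c \<in> T" "y \<in> ball c s" using T by (auto simp: S_def)
        have "p c \<in> S \<and> p c \<in> ball c s"
          unfolding p_def by (rule someI[of _ y]) (use y c in auto)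
        then have "y \<in> cball (p c) (8 * r / \<delta>)"
          using close[of "p c" c y] y c by (simp add: dist_norm norm_minus_commute)
        then show "y \<in> (\<Union>c\<in>T. cball (p c) (8 * r / \<delta>))" using c by blast
      qed
      then have "emeasure lebesgue S \<le> emeasure lebesgue (\<Union>c\<in>T. cball (p c) (8 * r / \<delta>))"
        by (rule emeasure_mono) (use T in auto)
      also have "\<dots> \<le> (\<Sum>c\<in>T. emeasure lebesgue (cball (p c) (8 * r / \<delta>)))"
        by (rule emeasure_subadditive_finite) (use T in auto)
      also have "\<dots> = (\<Sum>c\<in>T. ennreal (\<beta> * (8 * r / \<delta>)\<^sup>2))"
        using r \<delta>(1)
        by (intro sum.cong refl) (subst emeasure_lebesgue_cball, auto simp: \<beta>_def)
      also have "\<dots> = ennreal (real (card T) * (\<beta> * (8 * r / \<delta>)\<^sup>2))"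
        using \<beta> by (subst sum_ennreal) auto
      also have "\<dots> \<le> ennreal (C * r\<^sup>2)"
      proof (rule ennreal_leI)
        have "real (card T) * (\<beta> * (8 * r / \<delta>)\<^sup>2) \<le> (real (card T) + 1) * (\<beta> * (8 * r / \<delta>)\<^sup>2)"
          using \<beta> by (intro mult_right_mono) auto
        also have "\<dots> = C * r\<^sup>2"
          by (simp only: C_def power_mult_distrib power_divide mult_ac times_divide_eq_left times_divide_eq_right)
        finally show "real (card T) * (\<beta> * (8 * r / \<delta>)\<^sup>2) \<le> C * r\<^sup>2" .
      qed
      finally show ?thesis .
    qed
    then show "emeasure lebesgue {t \<in> G. norm (rps a t) \<le> r} \<le> ennreal (C * r\<^sup>2)"
      by (simp add: S_def)
  qed
qed

section \<open>The non-autonomous system\<close>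

text \<open>The translation part of the letter at level \<open>n + k\<close>, which becomes the
  coefficient of \<open>t ^ k\<close> in the coding map.\<close>

definition digit :: "nat \<Rightarrow> (nat \<Rightarrow> nat) \<Rightarrow> nat \<Rightarrow> real" where
  "digit n \<omega> k = (if \<omega> (n + k) = 1 then 0 else 1 / real (n + k))"

text \<open>At \<open>n + k = 0\<close> the quotient is 0 by the convention for division by zero, so
  the bound holds for every \<open>n\<close>.\<close>

lemma abs_digit_le_1: "\<bar>digit n \<omega> k\<bar> \<le> 1"
  by (cases "n + k") (auto simp: digit_def)

lemma disc_X_eq_cball: "disc_X = cball 0 (1 / (1 - 2 * 5 powr (- 5 / 8)))"
  by (auto simp: disc_X_def)

lemma param_U_norm: "t \<in> param_U \<Longrightarrow> norm t < 2 * 5 powr (- 5 / 8)"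
  and param_U_norm_less_1: "t \<in> param_U \<Longrightarrow> norm t < 1"
  and param_U_nonzero: "t \<in> param_U \<Longrightarrow> t \<noteq> 0"
  using param_bound_less_1 by (auto simp: param_U_def)

lemma family_Phi_affine:
  "family_Phi t j i = (\<lambda>z. t * z + (if i = 1 then 0 else 1 / of_nat j))"
  by (auto simp: family_Phi_def)

text \<open>Each new letter is composed as the innermost map, so its translation is multiplied by
  \<open>t ^ j\<close>.\<close>

lemma word_map_family_Phi:
  "word_map (family_Phi t) n j \<omega> = (\<lambda>z. t ^ j * z + (\<Sum>k<j. of_real (digit n \<omega> k) * t ^ k))"
proof (induction j)
  case 0
  show ?case by (simp add: id_def)
next
  case (Suc j)
  have "family_Phi t (n + j) (\<omega> (n + j)) = (\<lambda>z. t * z + of_real (digit n \<omega> j))"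
    by (auto simp: family_Phi_affine digit_def)
  then show ?case
    by (simp add: Suc o_def algebra_simps)
qed

lemma norm_rps_le:
  assumes "\<And>k. \<bar>a k\<bar> \<le> 1" "norm t < 1"
  shows "norm (rps a t) \<le> 1 / (1 - norm t)"
proof -
  have "norm (rps a t) \<le> (\<Sum>k. norm t ^ k)"
    unfolding rps_def
    by (rule norm_suminf_le[OF rps_term_bound]) (use assms in \<open>auto intro: summable_geometric\<close>)
  then show ?thesis using assms by (simp add: suminf_geometric)
qed

lemma rps_split:
  assumes "\<And>k. \<bar>a k\<bar> \<le> 1" "norm t < 1"
  shows "rps a t = t ^ j * rps (\<lambda>k. a (k + j)) t + (\<Sum>k<j. of_real (a k) * t ^ k)"
proof -
  have "summable (\<lambda>k. complex_of_real (a (k + j)) * t ^ k)"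
    using assms by (intro summable_rps) auto
  from suminf_mult[OF this, of "t ^ j"]
  have "(\<Sum>k. of_real (a (k + j)) * t ^ (k + j)) = t ^ j * rps (\<lambda>k. a (k + j)) t"
    by (simp add: rps_def power_add mult_ac)
  with suminf_split_initial_segment[OF summable_rps[of a, OF assms], of j] show ?thesis
    by (simp add: rps_def)
qed

text \<open>By \<open>rps_split\<close> the series is the image of its own tail, and the radius of
  \<open>disc_X\<close> is the geometric bound that keeps all tails in \<open>disc_X\<close>.
  Uniqueness holds because the images shrink like \<open>norm t ^ j\<close>.\<close>

lemma coding_map_family_Phi:
  assumes t: "t \<in> param_U"
  shows "coding_map disc_X (family_Phi t) n \<omega> = rps (digit n \<omega>) t"
proof -
  let ?x = "rps (digit n \<omega>) t"
  let ?S = "\<lambda>j. \<Sum>k<j. complex_of_real (digit n \<omega> k) * t ^ k"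
  define \<rho> :: real where "\<rho> = 1 / (1 - 2 * 5 powr (- 5 / 8))"
  note t1 = param_U_norm_less_1[OF t]
  have "1 / (1 - norm t) \<le> \<rho>"
    unfolding \<rho>_def using param_U_norm[OF t] param_bound_less_1 by (intro divide_left_mono) auto
  then have tail: "rps (\<lambda>k. digit n \<omega> (k + j)) t \<in> disc_X" for j
    using norm_rps_le[of "\<lambda>k. digit n \<omega> (k + j)" t] abs_digit_le_1 t1
    by (fastforce simp: disc_X_def \<rho>_def)
  note split = rps_split[of "digit n \<omega>" t, OF abs_digit_le_1 t1]
  have "(\<Inter>j\<in>{1..}. word_map (family_Phi t) n j \<omega> ` disc_X) = {?x}"
  proof (intro equalityI subsetI)
    fix y assume "y \<in> {?x}"
    then have y: "y = ?x" by simp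
    show "y \<in> (\<Inter>j\<in>{1..}. word_map (family_Phi t) n j \<omega> ` disc_X)"
      unfolding word_map_family_Phi y by (rule INT_I, rule image_eqI, rule split, rule tail)
  next
    fix y assume y: "y \<in> (\<Inter>j\<in>{1..}. word_map (family_Phi t) n j \<omega> ` disc_X)"
    \<comment> \<open>Both points are images of points of \<open>disc_X\<close> under the same
      affine map. The length is \<open>Suc j\<close> because the intersection starts at 1.\<close>
    have bound: "norm (y - ?x) \<le> norm t ^ Suc j * (2 * \<rho>)" for j
    proof -
      have "y \<in> word_map (family_Phi t) n (Suc j) \<omega> ` disc_X"
        by (rule INT_D[OF y]) simp
      then obtain z where z: "z \<in> disc_X" "y = t ^ Suc j * z + ?S (Suc j)"
        unfolding word_map_family_Phi by (elim imageE)
      have eq: "y - ?x = t ^ Suc j * (z - rps (\<lambda>k. digit n \<omega> (k + Suc j)) t)"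
        unfolding z(2) split[of "Suc j"] by (simp add: algebra_simps)
      have "norm (z - rps (\<lambda>k. digit n \<omega> (k + Suc j)) t) \<le> 2 * \<rho>"
        using norm_triangle_ineq4[of z "rps (\<lambda>k. digit n \<omega> (k + Suc j)) t"] z(1) tail[of "Suc j"]
        by (simp add: disc_X_def \<rho>_def)
      then show ?thesis
        unfolding eq norm_mult norm_power by (rule mult_left_mono) simp
    qed
    have "(\<lambda>j. norm t ^ Suc j * (2 * \<rho>)) \<longlonglongrightarrow> 0 * (2 * \<rho>)"
      using t1 by (intro tendsto_mult tendsto_const LIMSEQ_Suc LIMSEQ_realpow_zero) auto
    from LIMSEQ_le_const[OF this, of "norm (y - ?x)"] bound
    have "norm (y - ?x) \<le> 0" by simp
    then show "y \<in> {?x}" by simp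
  qed
  then show ?thesis
    unfolding coding_map_def by simp
qed

section \<open>Conformality and distortion of the affine maps\<close>

lemma has_conformal_factor_affine:
  fixes s c x :: complex
  assumes "s \<noteq> 0"
  shows "has_conformal_factor (\<lambda>z. s * z + c) x (norm s)"
proof -
  have "linear (\<lambda>v. s / of_real (norm s) * v)"
    by (intro bounded_linear.linear bounded_linear_mult_right)
  then have "orthogonal_transformation (\<lambda>v. s / of_real (norm s) * v)"
    using assms by (simp add: orthogonal_transformation norm_mult norm_divide)
  moreover have "((\<lambda>z. s * z + c) has_derivative (\<lambda>v. norm s *\<^sub>R (s / of_real (norm s) * v))) (at x)"
    using assms by (auto intro!: derivative_eq_intros simp: scaleR_conv_of_real)
  ultimately show ?thesis
    using assms unfolding has_conformal_factor_def by auto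
qed

lemma C1_on_affine: "C1_on (\<lambda>z::complex. s * z + c) V"
  unfolding C1_on_def
  by (intro exI[of _ "\<lambda>_. blinfun_mult_right s"])
     (auto intro!: derivative_eq_intros)

lemma conformal_on_affine:
  fixes s c :: complex
  assumes "s \<noteq> 0"
  shows "conformal_on (\<lambda>z. s * z + c) UNIV"
proof -
  have inv: "inv (\<lambda>z. s * z + c) = (\<lambda>y. (1 / s) * y + (- c / s))"
    using assms by (intro inv_equality) (auto simp: field_simps)
  have "surj (\<lambda>z. s * z + c)"
    by (rule surjI[of _ "\<lambda>y. (y - c) / s"]) (use assms in auto)
  then show ?thesis
    unfolding conformal_on_def C1_diffeo_on_def inv
    using assms has_conformal_factor_affine[OF assms] C1_on_affine C1_on_affine[of "1 / s" "- c / s" UNIV]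
    by (auto simp: inj_on_def)
qed

lemma conformal_on_family_Phi: "t \<in> param_U \<Longrightarrow> conformal_on (family_Phi t j i) UNIV"
  unfolding family_Phi_affine by (intro conformal_on_affine param_U_nonzero)

text \<open>Along a word the maps compose to an affine map with linear part \<open>t ^ j\<close>, so
  the factor depends neither on the point nor on the letters. Contraction, distortion with constant
  1 and distortion continuity all rest on this.\<close>

lemma conformal_factor_word_map:
  assumes "t \<in> param_U"
  shows "conformal_factor (word_map (family_Phi t) n j \<omega>) x = norm t ^ j"
  unfolding word_map_family_Phi
  using has_conformal_factor_affine[of "t ^ j"] param_U_nonzero[OF assms]
  by (intro conformal_factor_eq) (simp add: norm_power)

lemma disc_X_nonempty: "disc_X \<noteq> {}"
  using param_bound_less_1 by (auto simp: disc_X_eq_cball)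

lemma sup_conformal_factor_word_map:
  assumes "t \<in> param_U"
  shows "sup_conformal_factor disc_X (word_map (family_Phi t) n j \<omega>) = norm t ^ j"
  using disc_X_nonempty by (simp add: sup_conformal_factor_def conformal_factor_word_map[OF assms])

text \<open>The ratio is the exponential of \<open>j\<close> times a difference of values of
  \<open>ln (norm t)\<close>, so continuity of this logarithm at \<open>t0\<close> suffices.\<close>

lemma distortion_continuity_family_Phi:
  "distortion_continuity disc_X param_U index_I family_Phi"
  unfolding distortion_continuity_def
proof (intro allI impI ballI)
  fix \<eta> :: real and t0 assume \<eta>: "\<eta> > 0" and t0: "t0 \<in> param_U"
  have "isCont (\<lambda>t. ln (norm t)) t0"
    using param_U_nonzero[OF t0] by (intro continuous_intros) auto
  then obtain d where d: "d > 0" "\<And>t. dist t t0 < d \<Longrightarrow> dist (ln (norm t)) (ln (norm t0)) < \<eta>"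
    using \<eta> unfolding continuous_at_eps_delta by blast
  show "\<exists>\<delta>>0. \<forall>t\<in>param_U. norm (t - t0) \<le> \<delta> \<longrightarrow>
        (\<forall>n\<ge>1. \<forall>j\<ge>1. \<forall>\<omega>\<in>words_from index_I n.
           exp (- (real j * \<eta>))
             \<le> sup_conformal_factor disc_X (word_map (family_Phi t0) n j \<omega>)
                / sup_conformal_factor disc_X (word_map (family_Phi t) n j \<omega>) \<and>
           sup_conformal_factor disc_X (word_map (family_Phi t0) n j \<omega>)
                / sup_conformal_factor disc_X (word_map (family_Phi t) n j \<omega>)
             \<le> exp (real j * \<eta>))"
  \<comment> \<open>Halving turns the non-strict condition on \<open>t\<close> into the strict one
    of the continuity estimate.\<close>
  proof (intro exI[of _ "d / 2"] conjI ballI impI allI)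
    fix t and n j :: nat and \<omega> assume t: "t \<in> param_U" "norm (t - t0) \<le> d / 2"
    define u where "u = ln (norm t0) - ln (norm t)"
    have u: "\<bar>u\<bar> \<le> \<eta>"
      using d(2)[of t] t(2) d(1) by (simp add: dist_norm u_def)
    have "norm t0 ^ j / norm t ^ j = exp u ^ j"
      using param_U_nonzero[OF t(1)] param_U_nonzero[OF t0]
      by (simp add: u_def exp_diff power_divide)
    then have ratio: "norm t0 ^ j / norm t ^ j = exp (real j * u)"
      by (simp add: exp_of_nat_mult)
    have "real j * u \<le> real j * \<eta>" "real j * (- \<eta>) \<le> real j * u"
      using u by (intro mult_left_mono; simp add: abs_le_iff)+
    then show
      "exp (- (real j * \<eta>)) \<le> sup_conformal_factor disc_X (word_map (family_Phi t0) n j \<omega>)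
                / sup_conformal_factor disc_X (word_map (family_Phi t) n j \<omega>)"
      "sup_conformal_factor disc_X (word_map (family_Phi t0) n j \<omega>)
                / sup_conformal_factor disc_X (word_map (family_Phi t) n j \<omega>) \<le> exp (real j * \<eta>)"
      by (simp_all add: sup_conformal_factor_word_map t t0 ratio)
  qed (use d in simp)
qed

section \<open>Continuity and transversality of the coding map\<close>

lemma coding_continuity_family_Phi: "coding_continuity disc_X param_U index_I family_Phi"
  unfolding coding_continuity_def
proof (intro allI impI)
  fix n :: nat
  let ?P = "prod_topology (top_of_set param_U) (words_topology index_I n)"
  obtain q where q: "0 \<le> q" "q < 1" "param_U \<subseteq> cball 0 q"
    using subset_param_U_norm_bound[OF order_refl] .
  let ?S = "{a :: nat \<Rightarrow> real. \<forall>k. \<bar>a k\<bar> \<le> 1} \<times> cball (0 :: complex) q"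
  \<comment> \<open>Each digit depends on a single letter, and every function on the discrete
    alphabet is continuous.\<close>
  have digit: "continuous_map ?P euclidean (\<lambda>p. digit n (snd p) k)" for k
  proof -
    have "continuous_map (words_topology index_I n) (discrete_topology (index_I (n + k))) (\<lambda>\<omega>. \<omega> (n + k))"
      unfolding words_topology_def by (rule continuous_map_product_projection) simp
    from continuous_map_compose[OF continuous_map_snd this]
    have "continuous_map ?P (discrete_topology (index_I (n + k))) (\<lambda>p. snd p (n + k))"
      by (simp add: o_def)
    moreover have "continuous_map (discrete_topology (index_I (n + k))) euclidean
        (\<lambda>i. if i = 1 then 0 else 1 / real (n + k))"
      by simp
    ultimately have "continuous_map ?P euclidean
        ((\<lambda>i. if i = 1 then 0 else 1 / real (n + k)) \<circ> (\<lambda>p. snd p (n + k)))"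
      by (rule continuous_map_compose)
    then show ?thesis
      by (simp add: o_def digit_def)
  qed
  have "continuous_map ?P (product_topology (\<lambda>_. euclidean) UNIV) (\<lambda>p. digit n (snd p))"
    unfolding continuous_map_componentwise_UNIV using digit by blast
  then have "continuous_map ?P euclidean (\<lambda>p. digit n (snd p))"
    by (simp add: euclidean_product_topology)
  moreover have "continuous_map ?P euclidean fst"
    using continuous_map_fst[of "top_of_set param_U" "words_topology index_I n"]
    by (rule continuous_map_into_fulltopology)
  ultimately have "continuous_map ?P (prod_topology euclidean euclidean) (\<lambda>p. (digit n (snd p), fst p))"
    by (rule continuous_map_pairedI)
  then have "continuous_map ?P euclidean (\<lambda>p. (digit n (snd p), fst p))"
    by simp
  then have "continuous_map ?P (top_of_set ?S) (\<lambda>p. (digit n (snd p), fst p))"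
    using q(3) by (intro continuous_map_into_subtopology) (auto simp: abs_digit_le_1)
  moreover have "continuous_map (top_of_set ?S) euclidean (\<lambda>p. rps (fst p) (snd p))"
    using continuous_on_rps(1)[OF q(1,2)] by simp
  ultimately have "continuous_map ?P euclidean
      ((\<lambda>p. rps (fst p) (snd p)) \<circ> (\<lambda>p. (digit n (snd p), fst p)))"
    by (rule continuous_map_compose)
  then show "continuous_map ?P euclidean (\<lambda>(t, \<omega>). coding_map disc_X (family_Phi t) n \<omega>)"
    by (rule continuous_map_eq) (auto simp: coding_map_family_Phi)
qed

lemma transversality_family_Phi: "transversality disc_X param_U index_I family_Phi"
  unfolding transversality_def
proof (intro allI impI)
  fix G :: "complex set" assume "compact G \<and> G \<subseteq> param_U"
  then have G: "compact G" "G \<subseteq> param_U" by simp_all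
  obtain C where C: "C > 0"
    "\<And>a r. a 0 = 1 \<Longrightarrow> (\<And>k. \<bar>a k\<bar> \<le> 1) \<Longrightarrow> 0 < r \<Longrightarrow>
       emeasure lebesgue {t \<in> G. norm (rps a t) \<le> r} \<le> ennreal (C * r\<^sup>2)"
    using rps_sublevel_measure[OF G] by blast
  \<comment> \<open>Stated for one order of the two first letters; the other order follows by
    symmetry of the norm.\<close>
  have digit_difference: "emeasure lebesgue {t \<in> G. norm (rps (digit n \<omega>) t - rps (digit n \<tau>) t) \<le> r}
      \<le> ennreal (C * (real n)\<^sup>2 * r\<^sup>2)"
    if n: "n \<ge> 1" and r: "r > 0" and first: "\<omega> n \<noteq> 1" "\<tau> n = 1" for n \<omega> \<tau> r
  proof -
    \<comment> \<open>The first digits are \<open>1 / n\<close> and 0, and all later ones lie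
      between 0 and \<open>1 / n\<close>; multiplying by \<open>n\<close> therefore gives constant
      term 1 and coefficients in [-1, 1].\<close>
    define a where "a k = real n * (digit n \<omega> k - digit n \<tau> k)" for k
    have a0: "a 0 = 1" using n first by (simp add: a_def digit_def)
    have a1: "\<bar>a k\<bar> \<le> 1" for k
      using n by (auto simp: a_def digit_def abs_mult)
    have a_rps: "rps a t = of_nat n * (rps (digit n \<omega>) t - rps (digit n \<tau>) t)" if "t \<in> G" for t
    proof -
      have t: "norm t < 1" using that G param_U_norm_less_1 by blast
      note sm = summable_rps[of "digit n _", OF abs_digit_le_1 t]
      have "rps a t = (\<Sum>k. of_nat n * (of_real (digit n \<omega> k) * t ^ k - of_real (digit n \<tau> k) * t ^ k))"
        by (simp add: rps_def a_def algebra_simps)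
      also have "\<dots> = of_nat n * (\<Sum>k. of_real (digit n \<omega> k) * t ^ k - of_real (digit n \<tau> k) * t ^ k)"
        by (intro suminf_mult summable_diff sm)
      also have "\<dots> = of_nat n * (rps (digit n \<omega>) t - rps (digit n \<tau>) t)"
        unfolding rps_def by (simp add: suminf_diff[OF sm sm])
      finally show ?thesis .
    qed
    have "{t \<in> G. norm (rps (digit n \<omega>) t - rps (digit n \<tau>) t) \<le> r} = {t \<in> G. norm (rps a t) \<le> real n * r}"
      using n by (auto simp: a_rps norm_mult)
    also have "emeasure lebesgue \<dots> \<le> ennreal (C * (real n * r)\<^sup>2)"
      using n r by (intro C(2) a0 a1) auto
    finally show ?thesis by (simp add: power_mult_distrib mult.assoc)
  qed
  show "\<exists>C :: nat \<Rightarrow> real. (\<forall>n\<ge>1. C n > 0) \<and> (\<lambda>n. ln (C n) / real n) \<longlonglongrightarrow> 0 \<and>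
      (\<forall>n\<ge>1. \<forall>\<omega>\<in>words_from index_I n. \<forall>\<tau>\<in>words_from index_I n. \<omega> n \<noteq> \<tau> n \<longrightarrow>
         (\<forall>r>0. emeasure lebesgue
            {t \<in> G. norm (coding_map disc_X (family_Phi t) n \<omega> - coding_map disc_X (family_Phi t) n \<tau>) \<le> r}
            \<le> ennreal (C n * r ^ DIM(complex))))"
  \<comment> \<open>The rescaled series turns the radius \<open>r\<close> into \<open>n * r\<close>,
    whence the factor \<open>n\<^sup>2\<close>.\<close>
  proof (intro exI[of _ "\<lambda>n. C * (real n)\<^sup>2"] conjI allI impI ballI)
    show "0 < C * (real n)\<^sup>2" if "n \<ge> 1" for n using that C by simp
    have "(\<lambda>n. ln C / real n + 2 * (ln (real n) / real n)) \<longlonglongrightarrow> 0 + 2 * 0"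
      by (intro tendsto_intros lim_ln_over_n lim_const_over_n)
    moreover have "\<forall>\<^sub>F n in sequentially. ln C / real n + 2 * (ln (real n) / real n) = ln (C * (real n)\<^sup>2) / real n"
      using eventually_gt_at_top[of 0]
      by eventually_elim (use C in \<open>simp add: ln_mult ln_realpow add_divide_distrib\<close>)
    ultimately have "(\<lambda>n. ln (C * (real n)\<^sup>2) / real n) \<longlonglongrightarrow> 0 + 2 * 0"
      by (rule Lim_transform_eventually)
    then show "(\<lambda>n. ln (C * (real n)\<^sup>2) / real n) \<longlonglongrightarrow> 0" by simp
    fix n :: nat and \<omega> \<tau> :: "nat \<Rightarrow> nat" and r :: real
    assume n: "1 \<le> n" and w: "\<omega> \<in> words_from index_I n" "\<tau> \<in> words_from index_I n"
      and neq: "\<omega> n \<noteq> \<tau> n" and r: "0 < r"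
    have "\<omega> n \<in> {1, 2}" "\<tau> n \<in> {1, 2}"
      using w by (auto simp: words_from_def index_I_def PiE_iff)
    with neq consider "\<omega> n \<noteq> 1" "\<tau> n = 1" | "\<tau> n \<noteq> 1" "\<omega> n = 1" by fastforce
    then have "emeasure lebesgue {t \<in> G. norm (rps (digit n \<omega>) t - rps (digit n \<tau>) t) \<le> r}
        \<le> ennreal (C * (real n)\<^sup>2 * r\<^sup>2)"
    proof cases
      case 1
      then show ?thesis using digit_difference n r by blast
    next
      case 2
      then have "emeasure lebesgue {t \<in> G. norm (rps (digit n \<tau>) t - rps (digit n \<omega>) t) \<le> r}
        \<le> ennreal (C * (real n)\<^sup>2 * r\<^sup>2)" using digit_difference n r by blast
      then show ?thesis by (simp add: norm_minus_commute)
    qed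
    moreover have "{t \<in> G. norm (coding_map disc_X (family_Phi t) n \<omega> - coding_map disc_X (family_Phi t) n \<tau>) \<le> r}
        = {t \<in> G. norm (rps (digit n \<omega>) t - rps (digit n \<tau>) t) \<le> r}"
      using G coding_map_family_Phi by auto
    ultimately show "emeasure lebesgue
        {t \<in> G. norm (coding_map disc_X (family_Phi t) n \<omega> - coding_map disc_X (family_Phi t) n \<tau>) \<le> r}
        \<le> ennreal (C * (real n)\<^sup>2 * r ^ DIM(complex))"
      by simp
  qed
qed

section \<open>The disc, the parameter set and the open set condition\<close>

lemma family_Phi_maps_disc_X:
  assumes "t \<in> param_U" "j \<ge> 1"
  shows "family_Phi t j i ` disc_X \<subseteq> disc_X"
proof
  define q :: real where "q = 2 * 5 powr (- 5 / 8)"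
  have q: "q < 1" using param_bound_less_1 by (simp add: q_def)
  fix y assume "y \<in> family_Phi t j i ` disc_X"
  then obtain z where z: "norm z \<le> 1 / (1 - q)" and y: "y = t * z + (if i = 1 then 0 else 1 / of_nat j)"
    by (auto simp: disc_X_def q_def family_Phi_affine)
  have "norm y \<le> norm (t * z) + norm (if i = 1 then 0 else 1 / of_nat j :: complex)"
    unfolding y by (rule norm_triangle_ineq)
  also have "\<dots> \<le> q * (1 / (1 - q)) + 1"
    unfolding norm_mult using z param_U_norm[OF assms(1)] assms(2)
    by (intro add_mono mult_mono) (auto simp: q_def norm_divide)
  \<comment> \<open>The radius is the fixed point of \<open>x \<mapsto> q * x + 1\<close>.\<close>
  also have "\<dots> = 1 / (1 - q)" using q by (simp add: field_simps)
  finally show "y \<in> disc_X" by (simp add: disc_X_def q_def)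
qed

lemma open_param_U: "open param_U"
proof -
  have "param_U = ball 0 (2 * 5 powr (- 5 / 8)) - \<real>"
    by (auto simp: param_U_def)
  moreover have "open (ball 0 (2 * 5 powr (- 5 / 8)) - \<real> :: complex set)"
    by (intro open_Diff open_ball closed_complex_Reals)
  ultimately show ?thesis by simp
qed

lemma param_U_nonempty: "param_U \<noteq> {}"
proof -
  \<comment> \<open>A purely imaginary point at half the radius.\<close>
  have "5 powr (- 5 / 8) *\<^sub>R \<i> \<in> param_U"
    by (auto simp: param_U_def complex_is_Real_iff)
  then show ?thesis by blast
qed

text \<open>For large \<open>j\<close> the point \<open>1 / j\<close> lies in both images: it comes
  from 0 under the second map and from \<open>1 / (j * t)\<close> under the first.\<close>

lemma not_open_set_condition_family_Phi:
  assumes t: "t \<in> param_U"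
  shows "\<not> open_set_condition disc_X index_I (family_Phi t)"
proof
  assume osc: "open_set_condition disc_X index_I (family_Phi t)"
  define \<rho> :: real where "\<rho> = 1 / (1 - 2 * 5 powr (- 5 / 8))"
  have \<rho>: "\<rho> > 0" using param_bound_less_1 by (simp add: \<rho>_def)
  have t0: "t \<noteq> 0" using param_U_nonzero[OF t] .
  have int: "interior disc_X = ball 0 \<rho>"
    by (simp add: disc_X_eq_cball \<rho>_def interior_cball)
  \<comment> \<open>This places the preimage \<open>1 / (j * t)\<close> inside the open disc of
    radius \<open>\<rho>\<close>.\<close>
  obtain j where j: "1 / (norm t * \<rho>) < real j"
    using reals_Archimedean2 by blast
  have "0 < 1 / (norm t * \<rho>)" using t0 \<rho> by simp
  then have j1: "j \<ge> 1" using j by (cases j) auto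
  have "norm (1 / (of_nat j * t)) < \<rho>"
    using j j1 t0 \<rho> by (simp add: norm_divide norm_mult field_simps)
  then have "1 / of_nat j \<in> family_Phi t j 1 ` interior disc_X"
    unfolding int using t0 by (intro image_eqI[of _ _ "1 / (of_nat j * t)"]) (auto simp: family_Phi_def)
  moreover have "1 / of_nat j \<in> family_Phi t j 2 ` interior disc_X"
    unfolding int using \<rho> by (intro image_eqI[of _ _ 0]) (auto simp: family_Phi_def)
  moreover have "family_Phi t j 1 ` interior disc_X \<inter> family_Phi t j 2 ` interior disc_X = {}"
    using osc j1 unfolding open_set_condition_def index_I_def by simp
  ultimately show False by blast
qed

theorem theoremB:
  "TNCIFS disc_X param_U index_I family_Phi \<and>
   (\<forall>t\<in>param_U. \<not> open_set_condition disc_X index_I (family_Phi t))"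
proof
  \<comment> \<open>The affine maps are defined on the whole plane, so they serve as their own
    extensions with \<open>V = UNIV\<close>.\<close>
  have "conformality disc_X param_U index_I family_Phi UNIV family_Phi"
    unfolding conformality_def by (simp add: conformal_on_family_Phi connected_UNIV)
  moreover have "uniform_contraction param_U index_I UNIV family_Phi"
    unfolding uniform_contraction_def
  proof (intro exI[of _ "2 * 5 powr (- 5 / 8)"] conjI ballI allI impI)
    show "conformal_factor (word_map (family_Phi t) n j \<omega>) x \<le> (2 * 5 powr (- 5 / 8)) ^ j"
      if "t \<in> param_U" for t n j \<omega> x
      unfolding conformal_factor_word_map[OF that]
      by (intro power_mono less_imp_le[OF param_U_norm[OF that]]) simp
  qed (use param_bound_less_1 in auto)
  moreover have "bounded_distortion param_U index_I UNIV family_Phi"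
    unfolding bounded_distortion_def
    by (rule exI[of _ "\<lambda>_. 1"]) (simp add: conformal_factor_word_map)
  ultimately have "\<exists>V \<Psi>. conformality disc_X param_U index_I family_Phi V \<Psi> \<and>
      uniform_contraction param_U index_I V \<Psi> \<and> bounded_distortion param_U index_I V \<Psi> \<and>
      distortion_continuity disc_X param_U index_I \<Psi>"
    using distortion_continuity_family_Phi by blast
  moreover have "compact disc_X" "convex disc_X" "\<forall>j\<ge>1. finite (index_I j)"
    by (simp_all add: disc_X_eq_cball index_I_def)
  ultimately show "TNCIFS disc_X param_U index_I family_Phi"
    unfolding TNCIFS_def
    using disc_X_nonempty param_U_nonempty open_param_U family_Phi_maps_disc_X
      coding_continuity_family_Phi transversality_family_Phi
    by blast
  show "\<forall>t\<in>param_U. \<not> open_set_condition disc_X index_I (family_Phi t)"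
    using not_open_set_condition_family_Phi by blast
qed

end
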